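(* Consider the slow-fast piecewise-linear system (SFOCF) in $\mathbb{R}^n$ with flow $\varphi_t(z;\varepsilon)$, with the associated critical manifold $\mathcal{M}_0$, the reduced system on $\mathbb{R}^{n-k}$, and the sets $\Omega_\delta \subset \mathbb{R}^n$, all as defined in the context. Suppose $\mathcal{M}_0$ is globally stable and let $\Omega \subset \mathbb{R}^{n-k}$ be a strong trapping region for the reduced system. Then there exist $M > 0$, $N \ge M$, and $\varepsilon_{\rm max} \in (0,\varepsilon_1]$ such that $$\varphi_t(z;\varepsilon) \in \Omega_{\varepsilon N} \quad \text{for all } \varepsilon \in (0,\varepsilon_{\rm max}), \text{ all } z \in \Omega_{\varepsilon M}, \text{ and all } t \ge 0.$$
   Context: Let $1 \le k < n$ be integers, $\varepsilon_1 > 0$ and $\mu \in \mathbb{R}$. For $X \in \{L,R\}$ let $a^X : [0,\varepsilon_1] \to \mathbb{R}^k$ and $b^X : [0,\varepsilon_1] \to \mathbb{R}^{n-k}$ be $C^1$ functions. Let $e_1,\ldots,e_m$ be the standard basis of $\mathbb{R}^m$ (dimension clear from context), and $J_m = [\,0 \; e_1 \cdots e_{m-1}\,]$ the $m\times m$ matrix with ones on the superdiagonal and zeros elsewhere ($J_1 = 0$). Write $z = (x,y)$ with $x \in \mathbb{R}^k$, $y \in \mathbb{R}^{n-k}$, so $z_1 = x_1$. $\|\cdot\|$ is the Euclidean norm. The slow-fast observer canonical form (SFOCF) is the continuous piecewise-linear ODE $$\dot{x} = \left(J_k - a^X(\varepsilon) e_1^{\sf T}\right) x + e_k y_1, \qquad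 \dot{y} = \varepsilon\left(-b^X(\varepsilon) x_1 + J_{n-k}\, y + e_{n-k}\mu\right),$$ with $X = L$ if $x_1 \le 0$ and $X = R$ if $x_1 \ge 0$. Its flow on $\mathbb{R}^n$ is denoted $\varphi_t(z;\varepsilon)$, $\varepsilon \in [0,\varepsilon_1]$. Let $A_X = J_k - a^X(0) e_1^{\sf T}$. The layer equation, with parameter $y_1 \in \mathbb{R}$, is the ODE on $\mathbb{R}^k$: $\dot{x} = A_L x + e_k y_1$ for $x_1 \le 0$, $\dot{x} = A_R x + e_k y_1$ for $x_1 \ge 0$. When all eigenvalues of $A_L$ and $A_R$ have negative real part, this has the unique equilibrium $H(y_1)$, where $H(y_1) = \frac{y_1}{a^L_k(0)}\left(1, a^L_1(0), \ldots, a^L_{k-1}(0)\right)^{\sf T}$ for $y_1 \le 0$ and $H(y_1) = \frac{y_1}{a^R_k(0)}\left(1, a^R_1(0), \ldots, a^R_{k-1}(0)\right)^{\sf T}$ for $y_1 \ge 0$. The critical manifold is $\mathcal{M}_0 = \{(x,y) : x = H(y_1),\ y \in \mathbb{R}^{n-k}\}$. $\mathcal{M}_0$ is called globally stable if all eigenvalues of $A_L$ and $A_R$ have negative real part and, for every $y_1 \in \mathbb{R}$, $H(y_1)$ is a globally asymptotically stable equilibrium of the layer equation (i.e. asymptotically stable with basin of attraction equal to all of $\mathbb{R}^k$). The reduced system is the ODE on $\mathbb{R}^{n-k}$: $\frac{dy}{d\tau} = B_L y + e_{n-k}\mu$ for $y_1 \le 0$, $\frac{dy}{d\tau} = B_R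 y + e_{n-k}\mu$ for $y_1 \ge 0$, where $B_X = J_{n-k} - \frac{b^X(0)}{a^X_k(0)} e_1^{\sf T}$. A compact set $\Omega \subset \mathbb{R}^{n-k}$ with smooth boundary $\partial\Omega$ is a strong trapping region for the reduced system if it is a trapping region (forward orbits starting in $\Omega$ remain in $\Omega$) and there are no points on $\partial \Omega$ at which $\frac{dy}{d\tau}$ is tangent to $\partial\Omega$ (the zero vector counts as tangent; thus the vector field points strictly inwards at every point of $\partial\Omega$). For compact $\Omega \subset \mathbb{R}^{n-k}$ and $\delta > 0$, $\Omega_\delta = \{(x,y) \in \mathbb{R}^n : \|x - H(y_1)\| \le \delta,\ y \in \Omega\}$. *)

theory Defs
  imports "HOL-Analysis.Analysis"
begin

section \<open>Index types as initial segments of the positive integers\<close>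

text \<open>
  A linearly ordered finite type plays the role of the index set $1 < 2 < \dots < m$ of
  $m$-dimensional space, where $m$ is its cardinality (hence $m \ge 1$).
\<close>

text \<open>
  Synonyms for \<open>real^'m\<close> and \<open>real^'m^'m\<close>; the infix notation would insert the sort
  \<open>finite\<close> at every occurrence of \<open>'m\<close>, which clashes with \<open>{finite,linorder}\<close>.
\<close>

type_synonym 'm rvec = "(real, 'm) vec"
type_synonym 'm rmat = "((real, 'm) vec, 'm) vec"

definition first_ix :: "'m::{finite,linorder}" where
  "first_ix = Min UNIV"

definition last_ix :: "'m::{finite,linorder}" where
  "last_ix = Max UNIV"

definition e_first :: "('m::{finite,linorder}) rvec" where
  "e_first = axis first_ix 1"

definition e_last :: "('m::{finite,linorder}) rvec" where
  "e_last = axis last_ix 1"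

definition shift_mat :: "('m::{finite,linorder}) rmat" where
  "shift_mat = (\<chi> i j. if i < j \<and> (\<nexists>l. i < l \<and> l < j) then 1 else 0)"

text \<open>The matrix $J_m - a\, e_1^{\sf T}$.\<close>

definition obs_mat :: "'m rvec \<Rightarrow> ('m::{finite,linorder}) rmat" where
  "obs_mat a = shift_mat - (\<chi> i j. a $ i * e_first $ j)"

text \<open>
  Eigenvalues of a real matrix are taken over the complex numbers.
\<close>

definition complex_eigenvalue :: "('m::finite) rmat \<Rightarrow> complex \<Rightarrow> bool" where
  "complex_eigenvalue A c \<longleftrightarrow>
     (\<exists>v. v \<noteq> 0 \<and> map_matrix complex_of_real A *v v = c *s v)"


section \<open>Flows, stability, trapping regions\<close>

definition solution :: "('a \<Rightarrow> 'a) \<Rightarrow> 'a::real_normed_vector \<Rightarrow> (real \<Rightarrow> 'a) \<Rightarrow> bool" where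
  "solution f z u \<longleftrightarrow> u 0 = z \<and> (\<forall>s. (u has_vector_derivative f (u s)) (at s))"

text \<open>
  Only used for globally Lipschitz vector fields, for which the solution through each
  point exists on the whole real line and is unique.
\<close>

definition flow :: "('a \<Rightarrow> 'a) \<Rightarrow> real \<Rightarrow> 'a \<Rightarrow> 'a::real_normed_vector" where
  "flow f t z = (THE u. solution f z u) t"

definition equilibrium :: "('a \<Rightarrow> 'a) \<Rightarrow> 'a::real_normed_vector \<Rightarrow> bool" where
  "equilibrium f p \<longleftrightarrow> f p = 0"

definition lyapunov_stable :: "('a \<Rightarrow> 'a) \<Rightarrow> 'a::real_normed_vector \<Rightarrow> bool" where
  "lyapunov_stable f p \<longleftrightarrow>
     (\<forall>e>0. \<exists>d>0. \<forall>z. dist z p < d \<longrightarrow> (\<forall>t\<ge>0. dist (flow f t z) p < e))"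

definition basin :: "('a \<Rightarrow> 'a) \<Rightarrow> 'a::real_normed_vector \<Rightarrow> 'a set" where
  "basin f p = {z. ((\<lambda>t. flow f t z) \<longlongrightarrow> p) at_top}"

definition globally_asymptotically_stable :: "('a \<Rightarrow> 'a) \<Rightarrow> 'a::real_normed_vector \<Rightarrow> bool" where
  "globally_asymptotically_stable f p \<longleftrightarrow>
     equilibrium f p \<and> lyapunov_stable f p \<and> basin f p = UNIV"

definition trapping_region :: "('a \<Rightarrow> 'a) \<Rightarrow> 'a::real_normed_vector set \<Rightarrow> bool" where
  "trapping_region f S \<longleftrightarrow> (\<forall>z\<in>S. \<forall>t\<ge>0. flow f t z \<in> S)"

primrec Ck_on ::
    "nat \<Rightarrow> 'a::real_normed_vector set \<Rightarrow> ('a \<Rightarrow> 'b::real_normed_vector) \<Rightarrow> bool" where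
  "Ck_on 0 U g = continuous_on U g"
| "Ck_on (Suc n) U g =
     (\<exists>g'. (\<forall>x\<in>U. (g has_derivative g' x) (at x)) \<and> (\<forall>v. Ck_on n U (\<lambda>x. g' x v)))"

definition smooth_on :: "'a::real_normed_vector set \<Rightarrow> ('a \<Rightarrow> 'b::real_normed_vector) \<Rightarrow> bool" where
  "smooth_on U g \<longleftrightarrow> (\<forall>n. Ck_on n U g)"

text \<open>
  A smooth function presenting \<open>S\<close> near the point \<open>p\<close> as a sublevel set at a regular
  value; the frontier of \<open>S\<close> is then, near \<open>p\<close>, the regular level set \<open>g = 0\<close>.
\<close>

definition local_defining_function ::
    "'a::euclidean_space set \<Rightarrow> 'a \<Rightarrow> 'a set \<Rightarrow> ('a \<Rightarrow> real) \<Rightarrow> bool" where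
  "local_defining_function S p U g \<longleftrightarrow>
     open U \<and> p \<in> U \<and> g p = 0 \<and> smooth_on U g \<and>
     (\<forall>x\<in>U. \<exists>v. frechet_derivative g (at x) v \<noteq> 0) \<and>
     S \<inter> U = {x\<in>U. g x \<le> 0}"

definition smooth_boundary :: "'a::euclidean_space set \<Rightarrow> bool" where
  "smooth_boundary S \<longleftrightarrow> (\<forall>p\<in>frontier S. \<exists>U g. local_defining_function S p U g)"

text \<open>
  The tangent space of the frontier at \<open>p\<close> is the kernel of the differential of a local
  defining function; it does not depend on which one is chosen.
\<close>

definition tangent_to_frontier :: "'a::euclidean_space set \<Rightarrow> 'a \<Rightarrow> 'a \<Rightarrow> bool" where
  "tangent_to_frontier S p v \<longleftrightarrow>
     (\<exists>U g. local_defining_function S p U g \<and> frechet_derivative g (at p) v = 0)"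

definition strong_trapping_region :: "('a \<Rightarrow> 'a) \<Rightarrow> 'a::euclidean_space set \<Rightarrow> bool" where
  "strong_trapping_region f S \<longleftrightarrow>
     compact S \<and> smooth_boundary S \<and> trapping_region f S \<and>
     (\<forall>p\<in>frontier S. \<not> tangent_to_frontier S p (f p))"


section \<open>The slow-fast observer canonical form\<close>

text \<open>$C^1$ on a closed interval, with one-sided derivatives at the end points.\<close>

definition C1_on :: "real set \<Rightarrow> (real \<Rightarrow> 'a::real_normed_vector) \<Rightarrow> bool" where
  "C1_on I f \<longleftrightarrow>
     (\<exists>f'. (\<forall>s\<in>I. (f has_vector_derivative f' s) (at s within I)) \<and> continuous_on I f')"

text \<open>
  In the three piecewise definitions of vector fields below, the two pieces agree on the
  switching manifold, so giving it to the left piece is immaterial.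
\<close>

definition sfocf_field ::
    "(real \<Rightarrow> 'k rvec) \<Rightarrow> (real \<Rightarrow> 'k rvec) \<Rightarrow> (real \<Rightarrow> 'm rvec) \<Rightarrow> (real \<Rightarrow> 'm rvec) \<Rightarrow> real \<Rightarrow> real \<Rightarrow>
     ('k::{finite,linorder}) rvec \<times> ('m::{finite,linorder}) rvec \<Rightarrow> 'k rvec \<times> 'm rvec" where
  "sfocf_field aL aR bL bR \<mu> \<epsilon> = (\<lambda>(x, y).
     let a = (if x $ first_ix \<le> 0 then aL \<epsilon> else aR \<epsilon>);
         b = (if x $ first_ix \<le> 0 then bL \<epsilon> else bR \<epsilon>)
     in (obs_mat a *v x + y $ first_ix *\<^sub>R e_last,
         \<epsilon> *\<^sub>R (- (x $ first_ix *\<^sub>R b) + shift_mat *v y + \<mu> *\<^sub>R e_last)))"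

definition layer_field ::
    "(real \<Rightarrow> 'k rvec) \<Rightarrow> (real \<Rightarrow> 'k rvec) \<Rightarrow> real \<Rightarrow> ('k::{finite,linorder}) rvec \<Rightarrow> 'k rvec" where
  "layer_field aL aR y1 x =
     (if x $ first_ix \<le> 0 then obs_mat (aL 0) *v x + y1 *\<^sub>R e_last
      else obs_mat (aR 0) *v x + y1 *\<^sub>R e_last)"

text \<open>
  The vector $(1, a_1, \dots, a_{k-1})^{\sf T}$ is $e_1 + J_k^{\sf T} a$.
\<close>

definition crit_H ::
    "(real \<Rightarrow> 'k rvec) \<Rightarrow> (real \<Rightarrow> 'k rvec) \<Rightarrow> real \<Rightarrow> ('k::{finite,linorder}) rvec" where
  "crit_H aL aR y1 =
     (let a = (if y1 \<le> 0 then aL 0 else aR 0)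
      in (y1 / a $ last_ix) *\<^sub>R (e_first + transpose shift_mat *v a))"

text \<open>
  Global stability of the critical manifold $\{(x,y) : x = H(y_1)\}$.
\<close>

definition critical_manifold_globally_stable ::
    "(real \<Rightarrow> 'k rvec) \<Rightarrow> (real \<Rightarrow> ('k::{finite,linorder}) rvec) \<Rightarrow> bool" where
  "critical_manifold_globally_stable aL aR \<longleftrightarrow>
     (\<forall>c. complex_eigenvalue (obs_mat (aL 0)) c \<longrightarrow> Re c < 0) \<and>
     (\<forall>c. complex_eigenvalue (obs_mat (aR 0)) c \<longrightarrow> Re c < 0) \<and>
     (\<forall>y1. globally_asymptotically_stable (layer_field aL aR y1) (crit_H aL aR y1))"

definition reduced_field ::
    "(real \<Rightarrow> 'k rvec) \<Rightarrow> (real \<Rightarrow> ('k::{finite,linorder}) rvec) \<Rightarrow>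
     (real \<Rightarrow> 'm rvec) \<Rightarrow> (real \<Rightarrow> 'm rvec) \<Rightarrow> real \<Rightarrow> ('m::{finite,linorder}) rvec \<Rightarrow> 'm rvec" where
  "reduced_field aL aR bL bR \<mu> y =
     (if y $ first_ix \<le> 0 then obs_mat (bL 0 /\<^sub>R aL 0 $ last_ix) *v y + \<mu> *\<^sub>R e_last
      else obs_mat (bR 0 /\<^sub>R aR 0 $ last_ix) *v y + \<mu> *\<^sub>R e_last)"

definition tube ::
    "(real \<Rightarrow> 'k rvec) \<Rightarrow> (real \<Rightarrow> 'k rvec) \<Rightarrow> 'm rvec set \<Rightarrow> real \<Rightarrow>
     (('k::{finite,linorder}) rvec \<times> ('m::{finite,linorder}) rvec) set" where
  "tube aL aR \<Omega> \<delta> = {(x, y). norm (x - crit_H aL aR (y $ first_ix)) \<le> \<delta> \<and> y \<in> \<Omega>}"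

end

theory Submission
  imports Defs
begin

text \<open>
  The layer problem is jointly positively homogeneous in \<open>(x, y\<^sub>1)\<close>. Compactness together with
  this scaling turns asymptotic stability of the equilibria \<open>H y\<^sub>1\<close> into a uniform statement: the
  distance to \<open>H y\<^sub>1\<close> is halved within a time at most \<open>T\<close>, for all initial points and all
  \<open>y\<^sub>1\<close>. Only for \<open>H y\<^sub>1\<close> close to \<open>x\<close> relative to \<open>y\<^sub>1\<close> does compactness fail, but there the layer
  field is affine and the distance itself can be scaled. Over a time \<open>T\<close> the full system deviates
  by \<open>O(\<epsilon>)\<close> from the layer flow with frozen \<open>y\<^sub>1\<close>, so a tube of radius \<open>O(\<epsilon>)\<close> cannot be left
  through its side; nor can it be left through the frontier of \<open>\<Omega>\<close>, since transversality on a
  compact frontier survives small perturbations of the reduced field.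
\<close>

section \<open>Flows of Lipschitz vector fields\<close>

text \<open>Global asymptotic stability provides neither a decay rate nor a Lyapunov function, and
  \<open>H 0\<close> lies on the switching hyperplane, where the layer field is in general not
  differentiable. Halving within a bounded time replaces an exponential rate: it absorbs an additive
  error \<open>C\<close>, since \<open>M / 2 + C\<close> is at most \<open>M\<close> once
  \<open>M\<close> is at least \<open>2 * C\<close>. The affine regime near \<open>H y\<close>
  requires \<open>H y\<close> to be off the hyperplane for nonzero \<open>y\<close>. This amounts to
  nonzero last entries of \<open>aL 0\<close> and \<open>aR 0\<close>; they are in fact positive,
  because a characteristic polynomial with nonpositive constant term has a nonnegative real root. A
  further obstacle is circularity: the bounds on the velocities hold only inside the tube, whose
  radius is built from these bounds. It is broken by an induction over time that assumes containment
  up to the present instant, and by computing all constants for radius 1 in place of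
  \<open>\<epsilon> * N\<close>, which is imposed afterwards through
  \<open>\<epsilon> < 1 / N\<close>.\<close>

lemma has_vector_derivative_affine_arg:
  fixes x :: "real \<Rightarrow> 'a::real_normed_vector"
  assumes "(x has_vector_derivative d) (at (a + c * s))"
  shows "((\<lambda>s. x (a + c * s)) has_vector_derivative c *\<^sub>R d) (at s)"
proof -
  have "((\<lambda>s. a + c * s) has_vector_derivative c) (at s)"
    unfolding has_real_derivative_iff_has_vector_derivative[symmetric]
    by (auto intro!: derivative_eq_intros)
  from vector_diff_chain_at[OF this assms] show ?thesis by (simp add: o_def)
qed

text \<open>An antiderivative on the whole line serves as Picard operator for both directions of
  time at once.\<close>

lemma continuous_has_antiderivative:
  fixes h :: "real \<Rightarrow> 'a::euclidean_space"
  assumes "continuous_on UNIV h"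
  shows "\<exists>P. P 0 = 0 \<and> (\<forall>t. (P has_vector_derivative h t) (at t))"
proof -
  obtain F where F: "\<And>x. (F has_vector_derivative h x) (at x)"
    using einterval_antiderivative[of "-\<infinity>" "\<infinity>" h] assms
    by (auto simp: continuous_on_eq_continuous_at)
  then show ?thesis
    by (intro exI[of _ "\<lambda>t. F t - F 0"]) (auto intro!: derivative_eq_intros)
qed

text \<open>Integrating the exponential gains the factor \<open>1 / k\<close>, the source of the
  contraction in the existence proof. Negative times follow by reflection.\<close>

lemma antiderivative_exp_bound:
  fixes P h :: "real \<Rightarrow> 'a::real_normed_vector"
  assumes P0: "P 0 = 0" and P': "\<And>t. (P has_vector_derivative h t) (at t)"
    and h: "\<And>s. norm (h s) \<le> C * exp (k * \<bar>s\<bar>)" and k: "k > 0"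
  shows "norm (P t) \<le> C / k * exp (k * \<bar>t\<bar>)"
proof -
  have C: "C \<ge> 0" using order_trans[OF norm_ge_zero h[of 0]] by simp
  have pos: "norm (Q t) \<le> C / k * exp (k * t)"
    if Q0: "Q 0 = 0" and Q': "\<And>t. (Q has_vector_derivative g t) (at t)"
      and g: "\<And>s. norm (g s) \<le> C * exp (k * \<bar>s\<bar>)" and t: "t > 0"
    for Q g :: "real \<Rightarrow> 'a" and t
  proof -
    have "norm (Q t - Q 0) \<le> C / k * exp (k * t) - C / k * exp (k * 0)"
    proof (rule differentiable_bound_general[where f' = g and \<phi>' = "\<lambda>s. C * exp (k * s)"])
      show "continuous_on {0..t} Q"
        by (rule continuous_on_vector_derivative) (use Q' has_vector_derivative_at_within in blast)
      show "continuous_on {0..t} (\<lambda>s. C / k * exp (k * s))"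
        by (intro continuous_intros)
      show "((\<lambda>s. C / k * exp (k * s)) has_vector_derivative C * exp (k * s)) (at s)" for s
        unfolding has_real_derivative_iff_has_vector_derivative[symmetric]
        using k by (auto intro!: derivative_eq_intros)
      show "norm (g s) \<le> C * exp (k * s)" if "0 < s" for s
        using g[of s] that by simp
    qed (use t Q' in auto)
    also have "\<dots> \<le> C / k * exp (k * t)" using C k by simp
    finally show ?thesis using Q0 by simp
  qed
  consider "t = 0" | "t > 0" | "t < 0" by linarith
  then show ?thesis
  proof cases
    case 1 then show ?thesis using P0 C k by simp
  next
    case 2 then show ?thesis using pos[OF P0 P' h 2] by simp
  next
    case 3
    have "norm (P (- (- t))) \<le> C / k * exp (k * (- t))"
    proof (rule pos[where g = "\<lambda>s. - h (- s)"])
      show "((\<lambda>s. P (- s)) has_vector_derivative - h (- s)) (at s)" for s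
        using has_vector_derivative_affine_arg[of P "h (- s)" 0 "-1" s] P'[of "- s"] by simp
      show "norm (- h (- s)) \<le> C * exp (k * \<bar>s\<bar>)" for s using h[of "- s"] by simp
    qed (use 3 P0 in auto)
    then show ?thesis using 3 by simp
  qed
qed

lemma lipschitz_solution_exists:
  fixes f :: "'a::euclidean_space \<Rightarrow> 'a"
  assumes f: "L-lipschitz_on UNIV f"
  shows "\<exists>u. solution f z u"
proof -
  \<comment> \<open>The contraction factor will be \<open>L / k\<close>, which this choice keeps
    below \<open>1/2\<close>; the summand 1 makes \<open>k\<close> positive even for
    \<open>L = 0\<close>.\<close>
  define k where "k = 2 * (L + 1)"
  have L: "L \<ge> 0" using f by (rule lipschitz_on_nonneg)
  have k: "k > 0" using L by (simp add: k_def)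
  have fL: "norm (f x - f y) \<le> L * norm (x - y)" for x y
    using lipschitz_on_normD[OF f] by blast
  have fc: "continuous_on UNIV f" using f by (rule lipschitz_on_continuous_on)
  \<comment> \<open>Picard iteration in the weighted unknown \<open>v t = exp (- k \<bar>t\<bar>) u t\<close>: the weight keeps
    \<open>v\<close> bounded and makes the iteration a contraction on the whole line at once.\<close>
  define h where "h v s = f (exp (k * \<bar>s\<bar>) *\<^sub>R apply_bcontfun v s)" for v :: "real \<Rightarrow>\<^sub>C 'a" and s
  have hc: "continuous_on UNIV (h v)" for v
    unfolding h_def
    by (rule continuous_on_compose2[OF fc]) (auto intro!: continuous_intros)
  obtain P where P0: "\<And>v. P v 0 = 0"
      and P': "\<And>v t. (P v has_vector_derivative h v t) (at t)"
    using continuous_has_antiderivative[OF hc] by metis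
  have Pc: "continuous_on UNIV (P v)" for v
    by (rule continuous_on_vector_derivative) (use P' in blast)
  define G where "G v t = exp (- (k * \<bar>t\<bar>)) *\<^sub>R (z + P v t)" for v t
  have Pb: "\<exists>b. \<forall>t. norm (P v t) \<le> b * exp (k * \<bar>t\<bar>)" for v
  proof -
    have "norm (h v s) \<le> (norm (f 0) + L * norm v) * exp (k * \<bar>s\<bar>)" for s
    proof -
      have "norm (h v s) \<le> norm (f 0) + norm (h v s - f 0)"
        by (metis add.commute diff_add_cancel norm_triangle_ineq)
      also have "norm (h v s - f 0) \<le> L * (exp (k * \<bar>s\<bar>) * norm (apply_bcontfun v s))"
        using fL[of "exp (k * \<bar>s\<bar>) *\<^sub>R apply_bcontfun v s" 0] by (simp add: h_def)
      also have "\<dots> \<le> L * (exp (k * \<bar>s\<bar>) * norm v)"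
        using L by (intro mult_left_mono norm_bounded) auto
      also have "norm (f 0) \<le> norm (f 0) * exp (k * \<bar>s\<bar>)"
        using k by (simp add: mult_le_cancel_left1)
      finally show ?thesis by (simp add: algebra_simps)
    qed
    from antiderivative_exp_bound[OF P0 P' this k] show ?thesis by blast
  qed
  have Gb: "G v \<in> bcontfun" for v
  proof -
    obtain b where b: "\<And>t. norm (P v t) \<le> b * exp (k * \<bar>t\<bar>)" using Pb by blast
    show ?thesis
    proof (rule bcontfun_normI)
      show "continuous_on UNIV (G v)" unfolding G_def by (intro continuous_intros Pc)
      show "norm (G v t) \<le> norm z + b" for t
      proof -
        have "norm (G v t) \<le> exp (- (k * \<bar>t\<bar>)) * (norm z + b * exp (k * \<bar>t\<bar>))"
          unfolding G_def by (simp, rule order_trans[OF norm_triangle_ineq]) (use b in simp)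
        also have "\<dots> = exp (- (k * \<bar>t\<bar>)) * norm z + b"
          by (simp add: algebra_simps flip: exp_add)
        also have "\<dots> \<le> 1 * norm z + b"
          using k by (intro add_right_mono mult_right_mono) auto
        finally show ?thesis by simp
      qed
    qed
  qed
  define \<Phi> where "\<Phi> v = Bcontfun (G v)" for v
  have \<Phi>: "apply_bcontfun (\<Phi> v) = G v" for v
    unfolding \<Phi>_def using Gb by (rule Bcontfun_inverse)
  have contr: "dist (\<Phi> v) (\<Phi> w) \<le> 1/2 * dist v w" for v w
  proof (rule dist_bound)
    fix t
    have d: "norm (P v t - P w t) \<le> (L * dist v w) / k * exp (k * \<bar>t\<bar>)"
    proof (rule antiderivative_exp_bound[where h = "\<lambda>s. h v s - h w s", OF _ _ _ k])
      show "((\<lambda>t. P v t - P w t) has_vector_derivative h v s - h w s) (at s)" for s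
        by (intro derivative_intros P')
      fix s
      have "norm (h v s - h w s) \<le> L * (exp (k * \<bar>s\<bar>) * norm (apply_bcontfun v s - apply_bcontfun w s))"
        unfolding h_def using fL[of "exp (k * \<bar>s\<bar>) *\<^sub>R apply_bcontfun v s" "exp (k * \<bar>s\<bar>) *\<^sub>R apply_bcontfun w s"]
        by (simp flip: scaleR_diff_right)
      also have "\<dots> \<le> L * (exp (k * \<bar>s\<bar>) * dist v w)"
        using L by (intro mult_left_mono) (auto simp: dist_bounded simp flip: dist_norm)
      finally show "norm (h v s - h w s) \<le> L * dist v w * exp (k * \<bar>s\<bar>)" by (simp add: algebra_simps)
    qed (simp add: P0)
    have "dist (apply_bcontfun (\<Phi> v) t) (apply_bcontfun (\<Phi> w) t) = exp (- (k * \<bar>t\<bar>)) * norm (P v t - P w t)"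
      unfolding \<Phi> G_def dist_norm by (simp flip: scaleR_diff_right)
    also have "\<dots> \<le> exp (- (k * \<bar>t\<bar>)) * ((L * dist v w) / k * exp (k * \<bar>t\<bar>))"
      using d by (intro mult_left_mono) auto
    also have "\<dots> = L / k * dist v w" by (simp flip: exp_add)
    also have "\<dots> \<le> 1/2 * dist v w"
      using L k by (intro mult_right_mono) (auto simp: k_def field_simps)
    finally show "dist (apply_bcontfun (\<Phi> v) t) (apply_bcontfun (\<Phi> w) t) \<le> 1/2 * dist v w" .
  qed
  have "\<exists>!v. v \<in> UNIV \<and> \<Phi> v = v"
    by (rule Banach_fix[where c = "1/2"]) (use contr complete_UNIV in auto)
  then obtain v where v: "\<Phi> v = v" by auto
  define u where "u t = z + P v t" for t
  have "exp (k * \<bar>t\<bar>) *\<^sub>R apply_bcontfun v t = u t" for t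
  proof -
    have "apply_bcontfun v t = exp (- (k * \<bar>t\<bar>)) *\<^sub>R u t"
      using \<Phi>[of v] v by (simp add: G_def u_def)
    then show ?thesis by (simp flip: exp_add)
  qed
  then have "h v t = f (u t)" for t by (simp add: h_def)
  moreover have "(u has_vector_derivative h v t) (at t)" for t
    unfolding u_def by (auto intro!: derivative_eq_intros P')
  ultimately have "solution f z u"
    using P0 by (simp add: solution_def u_def)
  then show ?thesis by blast
qed

section \<open>Gronwall comparison, uniqueness and the flow\<close>

lemma approximate_solutions_close:
  fixes u v :: "real \<Rightarrow> 'a::real_inner"
  assumes f: "L-lipschitz_on UNIV f" and t: "0 \<le> t"
    and u': "\<And>s. 0 \<le> s \<Longrightarrow> s \<le> t \<Longrightarrow> (u has_vector_derivative f (u s)) (at s)"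
    and v': "\<And>s. 0 \<le> s \<Longrightarrow> s \<le> t \<Longrightarrow> (v has_vector_derivative v' s) (at s)"
    and d: "\<And>s. 0 \<le> s \<Longrightarrow> s \<le> t \<Longrightarrow> norm (v' s - f (v s)) \<le> d"
  shows "norm (u t - v t) \<le> exp ((2 * L + 1) * t) * (norm (u 0 - v 0) + d * (1 + t))"
proof -
  \<comment> \<open>Gronwall for the squared norm, which is differentiable also where
    \<open>w\<close> vanishes. The part \<open>2 * L\<close> comes from the Lipschitz term, the 1
    from \<open>2 * norm (w s) * d \<le> (norm (w s))\<^sup>2 + d\<^sup>2\<close>; the remaining
    \<open>d\<^sup>2\<close> is compensated by the linear term of \<open>q\<close>.\<close>
  define k where "k = 2 * L + 1"
  have L: "L \<ge> 0" using f by (rule lipschitz_on_nonneg)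
  have k: "k > 0" using L by (simp add: k_def)
  have d0: "d \<ge> 0" using order_trans[OF norm_ge_zero d[of 0]] t by simp
  define w where "w s = u s - v s" for s
  define q where "q s = exp (- (k * s)) * (w s \<bullet> w s) - d\<^sup>2 * s" for s
  have w': "(w has_vector_derivative f (u s) - v' s) (at s)" if "0 \<le> s" "s \<le> t" for s
    unfolding w_def using that by (intro derivative_intros u' v')
  have "\<exists>y. (q has_real_derivative y) (at s) \<and> y \<le> 0" if s: "0 \<le> s" "s \<le> t" for s
  proof -
    let ?w' = "f (u s) - v' s"
    have ww: "((\<lambda>s. w s \<bullet> w s) has_real_derivative 2 * (w s \<bullet> ?w')) (at s)"
    proof -
      have "((\<lambda>s. w s \<bullet> w s) has_derivative (\<lambda>h. w s \<bullet> (h *\<^sub>R ?w') + (h *\<^sub>R ?w') \<bullet> w s)) (at s)"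
        using w'[OF s] unfolding has_vector_derivative_def by (intro has_derivative_inner)
      moreover have "(\<lambda>h. w s \<bullet> (h *\<^sub>R ?w') + (h *\<^sub>R ?w') \<bullet> w s) = (*) (2 * (w s \<bullet> ?w'))"
        by (auto simp: inner_commute)
      ultimately show ?thesis by (simp add: has_field_derivative_def)
    qed
    have q': "(q has_real_derivative exp (- (k * s)) * (2 * (w s \<bullet> ?w') - k * (w s \<bullet> w s)) - d\<^sup>2) (at s)"
      unfolding q_def by (rule derivative_eq_intros ww refl)+ (simp add: algebra_simps)
    have "norm ?w' \<le> norm (f (u s) - f (v s)) + norm (v' s - f (v s))"
      using norm_triangle_ineq4[of "f (u s) - f (v s)" "v' s - f (v s)"] by simp
    also have "\<dots> \<le> L * norm (w s) + d"
      using lipschitz_on_normD[OF f, of "u s" "v s"] d[OF s] by (simp add: w_def)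
    finally have n: "norm ?w' \<le> L * norm (w s) + d" .
    have "w s \<bullet> ?w' \<le> norm (w s) * (L * norm (w s) + d)"
      by (rule order_trans[OF norm_cauchy_schwarz]) (use n in \<open>auto intro: mult_left_mono\<close>)
    then have "2 * (w s \<bullet> ?w') \<le> 2 * L * (norm (w s))\<^sup>2 + 2 * norm (w s) * d"
      by (simp add: power2_eq_square algebra_simps)
    also have "\<dots> \<le> 2 * L * (norm (w s))\<^sup>2 + (norm (w s))\<^sup>2 + d\<^sup>2"
      using sum_squares_bound[of "norm (w s)" d] by (simp add: algebra_simps)
    finally have "2 * (w s \<bullet> ?w') - k * (w s \<bullet> w s) \<le> d\<^sup>2"
      by (simp add: k_def algebra_simps power2_norm_eq_inner)
    then have "exp (- (k * s)) * (2 * (w s \<bullet> ?w') - k * (w s \<bullet> w s)) \<le> exp (- (k * s)) * d\<^sup>2"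
      by (intro mult_left_mono) auto
    also have "\<dots> \<le> 1 * d\<^sup>2" using k s by (intro mult_right_mono) auto
    finally show ?thesis using q' by auto
  qed
  then have "q t \<le> q 0"
    using DERIV_nonpos_imp_nonincreasing[OF t, of q] by blast
  then have "exp (- (k * t)) * (norm (w t))\<^sup>2 \<le> (norm (w 0))\<^sup>2 + d\<^sup>2 * t"
    by (simp add: q_def power2_norm_eq_inner)
  then have "exp (k * t) * (exp (- (k * t)) * (norm (w t))\<^sup>2) \<le> exp (k * t) * ((norm (w 0))\<^sup>2 + d\<^sup>2 * t)"
    by (intro mult_left_mono) auto
  then have "(norm (w t))\<^sup>2 \<le> exp (k * t) * ((norm (w 0))\<^sup>2 + d\<^sup>2 * t)"
    by (simp add: mult.assoc[symmetric] flip: exp_add)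
  \<comment> \<open>Both factors are enlarged to squares, so that the final bound is linear in the
    initial error and in \<open>d\<close>.\<close>
  also have "\<dots> \<le> (exp (k * t))\<^sup>2 * (norm (w 0) + d * (1 + t))\<^sup>2"
  proof (rule mult_mono)
    have "1 \<le> exp (k * t)" using k t by simp
    then show "exp (k * t) \<le> (exp (k * t))\<^sup>2" by (simp add: power2_eq_square)
    have "d\<^sup>2 * t \<le> d\<^sup>2 * (1 + t)\<^sup>2"
      using t by (intro mult_left_mono) (auto simp: power2_eq_square algebra_simps)
    then show "(norm (w 0))\<^sup>2 + d\<^sup>2 * t \<le> (norm (w 0) + d * (1 + t))\<^sup>2"
      using d0 t by (simp add: power2_sum power_mult_distrib add_increasing2)
  qed (use t in auto)
  finally have "(norm (w t))\<^sup>2 \<le> (exp (k * t) * (norm (w 0) + d * (1 + t)))\<^sup>2"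
    by (simp add: power_mult_distrib)
  then show ?thesis
    unfolding w_def k_def by (rule power2_le_imp_le) (use d0 t in auto)
qed

lemma solution_unique_forward:
  fixes u v :: "real \<Rightarrow> 'a::real_inner"
  assumes f: "L-lipschitz_on UNIV f" and t: "0 \<le> t"
    and "\<And>s. 0 \<le> s \<Longrightarrow> s \<le> t \<Longrightarrow> (u has_vector_derivative f (u s)) (at s)"
    and "\<And>s. 0 \<le> s \<Longrightarrow> s \<le> t \<Longrightarrow> (v has_vector_derivative f (v s)) (at s)"
    and "u 0 = v 0"
  shows "u t = v t"
  using approximate_solutions_close[OF assms(1-4), where d = 0] assms(5) by simp

text \<open>Uniqueness on the whole line is what the description operator in \<open>flow\<close>
  requires. Negative times reduce to positive ones for the field \<open>- f\<close>.\<close>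

lemma solution_unique:
  fixes u v :: "real \<Rightarrow> 'a::real_inner"
  assumes f: "L-lipschitz_on UNIV f" and u: "solution f z u" and v: "solution f z v"
  shows "u = v"
proof
  fix t :: real
  have u': "(u has_vector_derivative f (u s)) (at s)" and v': "(v has_vector_derivative f (v s)) (at s)" for s
    using u v by (auto simp: solution_def)
  show "u t = v t"
  proof (cases "t \<ge> 0")
    case True
    then show ?thesis
      by (rule solution_unique_forward[OF f]) (use u v in \<open>auto simp: solution_def\<close>)
  next
    case False
    have rev: "((\<lambda>s. x (- s)) has_vector_derivative - f (x (- s))) (at s)"
      if "\<And>s. (x has_vector_derivative f (x s)) (at s)" for x s
      using has_vector_derivative_affine_arg[of x "f (x (- s))" 0 "-1" s] that[of "- s"] by simp
    have "u (- (- t)) = v (- (- t))"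
    proof (rule solution_unique_forward[where f = "\<lambda>x. - f x" and L = L and u = "\<lambda>s. u (- s)" and v = "\<lambda>s. v (- s)"])
      show "L-lipschitz_on UNIV (\<lambda>x. - f x)" using f by simp
    qed (use False u v rev[OF u'] rev[OF v'] in \<open>auto simp: solution_def\<close>)
    then show ?thesis by simp
  qed
qed

lemma solution_flow:
  fixes f :: "'a::euclidean_space \<Rightarrow> 'a"
  assumes f: "L-lipschitz_on UNIV f"
  shows "solution f z (\<lambda>t. flow f t z)"
  unfolding flow_def
  using lipschitz_solution_exists[OF f] solution_unique[OF f] theI'[of "solution f z"] by blast

lemma flow_eqI:
  fixes f :: "'a::euclidean_space \<Rightarrow> 'a"
  assumes "L-lipschitz_on UNIV f" "solution f z u"
  shows "flow f t z = u t"
  using solution_unique[OF assms(1) solution_flow[OF assms(1)] assms(2)] by meson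

lemma
  fixes f :: "'a::euclidean_space \<Rightarrow> 'a"
  assumes f: "L-lipschitz_on UNIV f"
  shows flow_zero: "flow f 0 z = z"
    and flow_has_derivative: "((\<lambda>t. flow f t z) has_vector_derivative f (flow f t z)) (at t)"
  using solution_flow[OF f, of z] by (auto simp: solution_def)

lemma flow_equilibrium:
  fixes f :: "'a::euclidean_space \<Rightarrow> 'a"
  assumes "L-lipschitz_on UNIV f" "f p = 0"
  shows "flow f t p = p"
  by (rule flow_eqI[OF assms(1)]) (use assms(2) in \<open>auto simp: solution_def\<close>)

text \<open>The flow is restarted at time \<open>s\<close>, while \<open>v\<close> need not solve an
  autonomous equation. It is used with \<open>v\<close> an orbit for another parameter, the fast
  component of a full orbit, or a constant equilibrium.\<close>

lemma approximate_solution_flow_close: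
  fixes f :: "'a::euclidean_space \<Rightarrow> 'a"
  assumes f: "L-lipschitz_on UNIV f" and t: "s \<le> t"
    and v': "\<And>r. s \<le> r \<Longrightarrow> r \<le> t \<Longrightarrow> (v has_vector_derivative v' r) (at r)"
    and d: "\<And>r. s \<le> r \<Longrightarrow> r \<le> t \<Longrightarrow> norm (v' r - f (v r)) \<le> d"
  shows "norm (flow f (t - s) z - v t) \<le> exp ((2 * L + 1) * (t - s)) * (norm (z - v s) + d * (1 + (t - s)))"
proof -
  have "norm (flow f (t - s) z - v (s + (t - s)))
    \<le> exp ((2 * L + 1) * (t - s)) * (norm (flow f 0 z - v (s + 0)) + d * (1 + (t - s)))"
  proof (rule approximate_solutions_close[OF f, where v' = "\<lambda>r. v' (s + r)"])
    fix r assume r: "0 \<le> r" "r \<le> t - s"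
    show "((\<lambda>r. v (s + r)) has_vector_derivative v' (s + r)) (at r)"
      using has_vector_derivative_affine_arg[of v "v' (s + r)" s 1 r] v'[of "s + r"] r by simp
  qed (use t d flow_has_derivative[OF f] in auto)
  then show ?thesis by (simp add: flow_zero[OF f])
qed

section \<open>Uniform contraction of the layer flow\<close>

definition globally_lipschitz :: "('a::metric_space \<Rightarrow> 'b::metric_space) \<Rightarrow> bool" where
  "globally_lipschitz f \<longleftrightarrow> (\<exists>L. L-lipschitz_on UNIV f)"

named_theorems globally_lipschitz_intros

lemma globally_lipschitz_bounded_linear:
  "bounded_linear f \<Longrightarrow> globally_lipschitz f"
  unfolding globally_lipschitz_def using bounded_linear.lipschitz_boundE by blast

lemma globally_lipschitz_const [globally_lipschitz_intros]: "globally_lipschitz (\<lambda>x. c)"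
  unfolding globally_lipschitz_def using lipschitz_on_constant by blast

lemma globally_lipschitz_compose:
  assumes "globally_lipschitz f" "globally_lipschitz g"
  shows "globally_lipschitz (\<lambda>x. f (g x))"
proof -
  obtain L M where L: "L-lipschitz_on UNIV f" and M: "M-lipschitz_on UNIV g"
    using assms by (auto simp: globally_lipschitz_def)
  have "(L * M)-lipschitz_on UNIV (\<lambda>x. f (g x))"
    by (rule lipschitz_on_compose2[OF M lipschitz_on_subset[OF L]]) simp
  then show ?thesis by (auto simp: globally_lipschitz_def)
qed

lemma
  fixes f g :: "'a::metric_space \<Rightarrow> 'b::real_normed_vector"
  assumes "globally_lipschitz f" "globally_lipschitz g"
  shows globally_lipschitz_add [globally_lipschitz_intros]: "globally_lipschitz (\<lambda>x. f x + g x)"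
    and globally_lipschitz_diff [globally_lipschitz_intros]: "globally_lipschitz (\<lambda>x. f x - g x)"
  using assms lipschitz_on_add lipschitz_on_diff unfolding globally_lipschitz_def by blast+

lemma globally_lipschitz_Pair [globally_lipschitz_intros]:
  "globally_lipschitz f \<Longrightarrow> globally_lipschitz g \<Longrightarrow> globally_lipschitz (\<lambda>x. (f x, g x))"
  unfolding globally_lipschitz_def using lipschitz_on_Pair by blast

lemma globally_lipschitz_scaleR_left [globally_lipschitz_intros]:
  fixes c :: "'b::real_normed_vector"
  assumes "globally_lipschitz f"
  shows "globally_lipschitz (\<lambda>x. f x *\<^sub>R c)"
  by (rule globally_lipschitz_compose[OF globally_lipschitz_bounded_linear assms])
    (rule bounded_linear_scaleR_left)

lemma globally_lipschitz_scaleR_right [globally_lipschitz_intros]: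
  fixes f :: "'a::metric_space \<Rightarrow> 'b::real_normed_vector"
  assumes "globally_lipschitz f"
  shows "globally_lipschitz (\<lambda>x. r *\<^sub>R f x)"
  by (rule globally_lipschitz_compose[OF globally_lipschitz_bounded_linear assms])
    (rule bounded_linear_scaleR_right)

lemma
  fixes f :: "'a::metric_space \<Rightarrow> real"
  assumes f: "globally_lipschitz f"
  shows globally_lipschitz_min [globally_lipschitz_intros]: "globally_lipschitz (\<lambda>x. min (f x) 0)"
    and globally_lipschitz_max [globally_lipschitz_intros]: "globally_lipschitz (\<lambda>x. max (f x) 0)"
proof -
  have "1-lipschitz_on UNIV (\<lambda>x::real. min x 0)" "1-lipschitz_on UNIV (\<lambda>x::real. max x 0)"
    by (auto intro!: lipschitz_onI simp: dist_real_def)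
  then have *: "globally_lipschitz (\<lambda>x::real. min x 0)" "globally_lipschitz (\<lambda>x::real. max x 0)"
    unfolding globally_lipschitz_def by blast+
  show "globally_lipschitz (\<lambda>x. min (f x) 0)" by (rule globally_lipschitz_compose[OF *(1) f])
  show "globally_lipschitz (\<lambda>x. max (f x) 0)" by (rule globally_lipschitz_compose[OF *(2) f])
qed

section \<open>Homogeneity and continuity of the layer flow\<close>

locale piecewise_linear_layer =
  fixes J :: "'a::euclidean_space \<Rightarrow> 'a" and l :: "'a \<Rightarrow> real" and cL cR e hL hR :: 'a
  assumes J: "bounded_linear J" and l: "bounded_linear l"
begin

text \<open>The layer field with \<open>l x\<close> in the role of the first coordinate. Writing the
  two pieces with \<open>min\<close> and \<open>max\<close> makes continuity across the switching
  hyperplane and positive homogeneity visible without case distinctions.\<close>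

definition F :: "real \<Rightarrow> 'a \<Rightarrow> 'a" where
  "F y x = J x - min (l x) 0 *\<^sub>R cL - max (l x) 0 *\<^sub>R cR + y *\<^sub>R e"

definition H :: "real \<Rightarrow> 'a" where
  "H y = min y 0 *\<^sub>R hL + max y 0 *\<^sub>R hR"

text \<open>The parameter \<open>y\<close> only translates the field, hence one constant serves all
  \<open>y\<close>. This uniformity enters every later estimate with frozen
  \<open>y\<close>.\<close>

lemma F_lipschitz: obtains L where "\<And>y. L-lipschitz_on UNIV (F y)"
proof -
  have "globally_lipschitz (F 0)"
    unfolding F_def[abs_def] by (intro globally_lipschitz_intros globally_lipschitz_bounded_linear[OF J]
        globally_lipschitz_bounded_linear[OF l])
  then obtain L where L: "L-lipschitz_on UNIV (F 0)" by (auto simp: globally_lipschitz_def)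
  have "dist (F y x) (F y x') = dist (F 0 x) (F 0 x')" for x x' y
    by (simp add: F_def dist_norm)
  then have "L-lipschitz_on UNIV (F y)" for y
    using L unfolding lipschitz_on_def by metis
  then show ?thesis by (rule that)
qed

lemma F_scale: "c \<ge> 0 \<Longrightarrow> F (c * y) (c *\<^sub>R x) = c *\<^sub>R F y x"
proof -
  assume c: "c \<ge> 0"
  have "max (c * l x) 0 = c * max (l x) 0" "min (c * l x) 0 = c * min (l x) 0"
    using c by (auto simp: max_def min_def mult_le_0_iff zero_le_mult_iff)
  then show ?thesis
    using bounded_linear.linear[OF l] bounded_linear.linear[OF J]
    by (simp add: F_def linear_cmul algebra_simps)
qed

lemma H_scale: "c \<ge> 0 \<Longrightarrow> H (c * y) = c *\<^sub>R H y"
  by (cases "y \<ge> 0") (auto simp: H_def max_def min_def mult_le_0_iff zero_le_mult_iff)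

lemma H_lipschitz: "norm (H y - H y') \<le> (norm hL + norm hR) * \<bar>y - y'\<bar>"
proof -
  have "H y - H y' = (min y 0 - min y' 0) *\<^sub>R hL + (max y 0 - max y' 0) *\<^sub>R hR"
    by (simp add: H_def algebra_simps)
  also have "norm \<dots> \<le> \<bar>min y 0 - min y' 0\<bar> * norm hL + \<bar>max y 0 - max y' 0\<bar> * norm hR"
    by (rule order_trans[OF norm_triangle_ineq]) simp
  also have "\<dots> \<le> \<bar>y - y'\<bar> * norm hL + \<bar>y - y'\<bar> * norm hR"
    by (intro add_mono mult_right_mono) auto
  finally show ?thesis by (simp add: algebra_simps)
qed

lemma H_0 [simp]: "H 0 = 0"
  by (simp add: H_def)

lemma continuous_on_H: "continuous_on S H"
  unfolding H_def by (intro continuous_intros)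

lemma flow_scale:
  assumes c: "c \<ge> 0"
  shows "flow (F (c * y)) t (c *\<^sub>R x) = c *\<^sub>R flow (F y) t x"
proof -
  obtain L where L: "\<And>y. L-lipschitz_on UNIV (F y)" using F_lipschitz by blast
  show ?thesis
    by (rule flow_eqI[OF L])
      (auto simp: solution_def flow_zero[OF L] F_scale[OF c] intro!: derivative_eq_intros flow_has_derivative[OF L])
qed

text \<open>A change of the parameter is a constant defect \<open>(y - y') *\<^sub>R e\<close>, so
  the Gronwall estimate yields joint Lipschitz continuity in the initial point and the
  parameter.\<close>

lemma continuous_on_flow:
  assumes t: "t \<ge> 0"
  shows "continuous_on S (\<lambda>(x, y). flow (F y) t x)"
proof -
  obtain L where L: "\<And>y. L-lipschitz_on UNIV (F y)" using F_lipschitz by blast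
  have L0: "L \<ge> 0" using L[of 0] by (rule lipschitz_on_nonneg)
  let ?C = "exp ((2 * L + 1) * t) * (1 + norm e * (1 + t))"
  have "?C-lipschitz_on S (\<lambda>(x, y). flow (F y) t x)"
  proof (rule lipschitz_onI, clarify)
    fix x x' :: 'a and y y' :: real
    have x: "dist x x' \<le> dist (x, y) (x', y')" and y: "dist y y' \<le> dist (x, y) (x', y')"
      by (metis dist_fst_le fst_conv, metis dist_snd_le snd_conv)
    have "norm (flow (F y) (t - 0) x - flow (F y') t x')
      \<le> exp ((2 * L + 1) * (t - 0)) * (norm (x - flow (F y') 0 x') + (dist y y' * norm e) * (1 + (t - 0)))"
      by (rule approximate_solution_flow_close[OF L t flow_has_derivative[OF L]])
        (simp add: F_def dist_norm abs_minus_commute flip: scaleR_diff_left)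
    also have "\<dots> \<le> exp ((2 * L + 1) * t) * (dist (x, y) (x', y') + (dist (x, y) (x', y') * norm e) * (1 + t))"
      unfolding flow_zero[OF L] diff_zero dist_norm[symmetric] using t x y
      by (intro mult_left_mono add_mono mult_right_mono) auto
    finally show "dist (flow (F y) t x) (flow (F y') t x') \<le> ?C * dist (x, y) (x', y')"
      by (simp add: dist_norm algebra_simps)
  qed (use t L0 in auto)
  then show ?thesis by (rule lipschitz_on_continuous_on)
qed

end

text \<open>The conditions \<open>lL\<close> and \<open>lR\<close> place \<open>H y\<close> strictly
  on one side of the switching hyperplane for every nonzero \<open>y\<close>.\<close>

locale stable_layer = piecewise_linear_layer +
  assumes gas: "globally_asymptotically_stable (F y) (H y)"
    and lL: "l hL \<noteq> 0" and lR: "l hR \<noteq> 0"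
begin

text \<open>The inequality is not strict, so that it also holds at the equilibrium itself and
  survives scaling by 0.\<close>

definition halves :: "real \<Rightarrow> 'a \<Rightarrow> real \<Rightarrow> bool" where
  "halves t x y \<longleftrightarrow> norm (flow (F y) t x - H y) \<le> 1/2 * norm (x - H y)"

lemma F_H: "F y (H y) = 0"
  using gas by (simp add: globally_asymptotically_stable_def equilibrium_def)

lemma halves_scale:
  assumes "halves t x y" "c \<ge> 0"
  shows "halves t (c *\<^sub>R x) (c * y)"
  using mult_left_mono[OF assms(1)[unfolded halves_def] assms(2)] assms(2) unfolding halves_def
  by (simp add: flow_scale H_scale flip: scaleR_diff_right)

text \<open>Convergence gives a time for each point, continuity of the flow keeps it valid nearby,
  and finitely many times suffice. The time must stay dependent on the point: the distance may grow
  again after being halved, so the maximum only bounds the times. The lower bound 1 guarantees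
  progress when halvings are iterated.\<close>

lemma halves_uniform_on_compact:
  assumes S: "compact S" and ne: "\<And>x y. (x, y) \<in> S \<Longrightarrow> x \<noteq> H y"
  shows "\<exists>T\<ge>1. \<forall>x y. (x, y) \<in> S \<longrightarrow> (\<exists>t. 1 \<le> t \<and> t \<le> T \<and> halves t x y)"
proof -
  define U where "U t = {(x, y). norm (flow (F y) t x - H y) < 1/2 * norm (x - H y)}" for t
  have openU: "open (U t)" if "t \<ge> 1" for t
  proof -
    have "t \<ge> 0" using that by simp
    then have "continuous_on UNIV (\<lambda>p. flow (F (snd p)) t (fst p))"
      using continuous_on_flow[of t UNIV] by (simp add: case_prod_beta)
    moreover have "continuous_on UNIV (\<lambda>p::'a \<times> real. H (snd p))"
      by (rule continuous_on_compose2[OF continuous_on_H]) (auto intro!: continuous_intros)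
    ultimately have "open {p. norm (flow (F (snd p)) t (fst p) - H (snd p)) < 1/2 * norm (fst p - H (snd p))}"
      by (intro open_Collect_less continuous_intros)
    then show ?thesis unfolding U_def case_prod_unfold .
  qed
  have "S \<subseteq> (\<Union>t\<in>{1..}. U t)"
  proof clarify
    fix x y assume xy: "(x, y) \<in> S"
    have "((\<lambda>t. flow (F y) t x) \<longlongrightarrow> H y) at_top"
      using gas[of y] by (auto simp: globally_asymptotically_stable_def basin_def)
    then have "\<forall>\<^sub>F t in at_top. dist (flow (F y) t x) (H y) < 1/2 * norm (x - H y)"
      by (rule tendstoD) (use ne[OF xy] in auto)
    moreover have "\<forall>\<^sub>F t::real in at_top. 1 \<le> t" by (rule eventually_ge_at_top)
    ultimately have "\<forall>\<^sub>F t in at_top. 1 \<le> t \<and> (x, y) \<in> U t"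
      by eventually_elim (auto simp: U_def dist_norm)
    then show "(x, y) \<in> (\<Union>t\<in>{1..}. U t)"
      using eventually_happens'[OF trivial_limit_at_top_linorder] by fastforce
  qed
  then obtain D where D: "D \<subseteq> {1..}" "finite D" "S \<subseteq> (\<Union>t\<in>D. U t)"
    using compactE_image[OF S, of "{1..}" U] openU by auto
  show ?thesis
  proof (rule exI[of _ "Max (insert 1 D)"], intro conjI allI impI)
    show "1 \<le> Max (insert 1 D)" using D by simp
    fix x y assume "(x, y) \<in> S"
    then obtain t where "t \<in> D" "(x, y) \<in> U t" using D by blast
    moreover from this have "t \<le> Max (insert 1 D)" "1 \<le> t" using D by auto
    ultimately show "\<exists>t\<ge>1. t \<le> Max (insert 1 D) \<and> halves t x y"
      by (intro exI[of _ t]) (auto simp: U_def halves_def)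
  qed
qed

text \<open>Under the bound on \<open>l w\<close> the whole segment from \<open>H y\<close> to
  \<open>H y + w\<close> lies on one side of the switching hyperplane, where the field is affine; it
  vanishes at \<open>H y\<close>.\<close>

lemma F_affine_near_equilibrium:
  assumes w: "\<bar>l w\<bar> < \<bar>l (H y)\<bar>" and c: "0 \<le> c" "c \<le> 1"
  shows "F y (H y + c *\<^sub>R w) = c *\<^sub>R F y (H y + w)"
proof -
  let ?p = "H y"
  have lin: "linear l" "linear J" using J l by (auto intro: bounded_linear.linear)
  have cw: "\<bar>c * l w\<bar> < \<bar>l ?p\<bar>"
  proof -
    have "\<bar>c * l w\<bar> \<le> 1 * \<bar>l w\<bar>" unfolding abs_mult using c by (intro mult_right_mono) auto
    with w show ?thesis by simp
  qed
  have z: "J ?p - min (l ?p) 0 *\<^sub>R cL - max (l ?p) 0 *\<^sub>R cR + y *\<^sub>R e = 0"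
    using F_H[of y] by (simp add: F_def)
  have *: "F y (?p + v) = J v - (if l ?p > 0 then l v *\<^sub>R cR else l v *\<^sub>R cL)" if "\<bar>l v\<bar> < \<bar>l ?p\<bar>" for v
  proof (cases "l ?p > 0")
    case True
    then have "l ?p + l v > 0" using that by linarith
    moreover have "J ?p + y *\<^sub>R e = l ?p *\<^sub>R cR" using z True by (simp add: algebra_simps)
    ultimately show ?thesis using True by (simp add: F_def linear_add[OF lin(1)] linear_add[OF lin(2)] algebra_simps)
  next
    case False
    then have "l ?p + l v < 0" "l ?p < 0" using that by linarith+
    moreover from this have "J ?p + y *\<^sub>R e = l ?p *\<^sub>R cL" using z by (simp add: algebra_simps)
    ultimately show ?thesis by (simp add: F_def linear_add[OF lin(1)] linear_add[OF lin(2)] algebra_simps)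
  qed
  show ?thesis
    unfolding *[OF w] using *[of "c *\<^sub>R w"] cw lin by (simp add: linear_cmul scaleR_diff_right)
qed

text \<open>The ball contains the equilibrium, where strict halving fails and compactness gives
  nothing. Its boundary sphere is compact and avoids the equilibrium; since orbits from the sphere
  stay in the affine region, shrinking them towards \<open>H y\<close> gives orbits again, and the
  halving times carry over to the ball.\<close>

lemma halves_near_equilibrium:
  assumes y: "l (H y) \<noteq> 0"
  shows "\<exists>r>0. \<exists>T\<ge>1. \<forall>x. norm (x - H y) \<le> r \<longrightarrow> (\<exists>t. 1 \<le> t \<and> t \<le> T \<and> halves t x y)"
proof -
  let ?p = "H y"
  obtain L where L: "\<And>y. L-lipschitz_on UNIV (F y)" using F_lipschitz by blast
  obtain Kl where Kl: "Kl > 0" "\<And>x. norm (l x) \<le> norm x * Kl"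
    using bounded_linear.pos_bounded[OF l] by blast
  \<comment> \<open>Within this distance of \<open>?p\<close> the value of \<open>l\<close> changes
    by less than \<open>\<bar>l ?p\<bar>\<close>. Lyapunov stability therefore keeps orbits starting
    within \<open>d\<close> on one side of the hyperplane.\<close>
  have "\<bar>l ?p\<bar> / Kl > 0" using y Kl by simp
  then obtain d where d: "d > 0" "\<And>z t. dist z ?p < d \<Longrightarrow> t \<ge> 0 \<Longrightarrow> dist (flow (F y) t z) ?p < \<bar>l ?p\<bar> / Kl"
    using gas[of y] unfolding globally_asymptotically_stable_def lyapunov_stable_def by meson
  define r where "r = d / 2"
  have r: "r > 0" using d by (simp add: r_def)
  define S where "S = sphere ?p r \<times> {y}"
  have "compact S" unfolding S_def by (intro compact_Times) auto
  moreover have "x \<noteq> H y'" if "(x, y') \<in> S" for x y' using that r by (auto simp: S_def)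
  ultimately obtain T where T: "T \<ge> 1"
    "\<And>x. x \<in> sphere ?p r \<Longrightarrow> \<exists>t. 1 \<le> t \<and> t \<le> T \<and> halves t x y"
    using halves_uniform_on_compact[of S] unfolding S_def by blast
  have "\<exists>t. 1 \<le> t \<and> t \<le> T \<and> halves t x y" if x: "norm (x - ?p) \<le> r" for x
  proof (cases "x = ?p")
    case True
    then show ?thesis using T(1) by (intro exI[of _ 1]) (simp add: halves_def flow_equilibrium[OF L F_H])
  next
    case False
    define c where "c = norm (x - ?p) / r"
    have c: "0 < c" "c \<le> 1" using False x r by (auto simp: c_def)
    define x' where "x' = ?p + (1 / c) *\<^sub>R (x - ?p)"
    have nx': "norm (x' - ?p) = r" using False r by (simp add: x'_def c_def)
    then have "x' \<in> sphere ?p r" by (simp add: dist_norm norm_minus_commute)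
    then obtain t where t: "1 \<le> t" "t \<le> T" "halves t x' y" using T(2) by blast
    have near: "\<bar>l (flow (F y) s x' - ?p)\<bar> < \<bar>l ?p\<bar>" if "s \<ge> 0" for s
    proof -
      have "norm (flow (F y) s x' - ?p) < \<bar>l ?p\<bar> / Kl"
        using d(2)[of x' s] that nx' r by (simp add: dist_norm r_def)
      then show ?thesis
        using Kl(2)[of "flow (F y) s x' - ?p"] Kl(1) by (simp add: field_simps)
    qed
    have "flow (F y) t x = ?p + c *\<^sub>R (flow (F y) t x' - ?p)"
    proof (rule solution_unique_forward[OF L, where u = "\<lambda>s. flow (F y) s x"
          and v = "\<lambda>s. ?p + c *\<^sub>R (flow (F y) s x' - ?p)"])
      fix s assume s: "0 \<le> s" "s \<le> t"
      show "((\<lambda>s. flow (F y) s x) has_vector_derivative F y (flow (F y) s x)) (at s)"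
        by (rule flow_has_derivative[OF L])
      have "((\<lambda>s. ?p + c *\<^sub>R (flow (F y) s x' - ?p)) has_vector_derivative c *\<^sub>R F y (flow (F y) s x')) (at s)"
        by (auto intro!: derivative_eq_intros flow_has_derivative[OF L])
      then show "((\<lambda>s. ?p + c *\<^sub>R (flow (F y) s x' - ?p)) has_vector_derivative
          F y (?p + c *\<^sub>R (flow (F y) s x' - ?p))) (at s)"
        using F_affine_near_equilibrium[OF near[OF s(1)], of c] c by simp
    qed (use t c in \<open>auto simp: flow_zero[OF L] x'_def\<close>)
    then have "norm (flow (F y) t x - ?p) = c * norm (flow (F y) t x' - ?p)" using c by simp
    also have "\<dots> \<le> c * (1/2 * norm (x' - ?p))"
      using t c unfolding halves_def by (intro mult_left_mono) auto
    also have "\<dots> = 1/2 * norm (x - ?p)" using nx' r by (simp add: c_def)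
    finally show ?thesis using t by (auto simp: halves_def)
  qed
  then show ?thesis using r T(1) by blast
qed

lemma uniform_halving:
  "\<exists>T\<ge>1. \<forall>x y. \<exists>t. 1 \<le> t \<and> t \<le> T \<and> halves t x y"
proof -
  obtain L where L: "\<And>y. L-lipschitz_on UNIV (F y)" using F_lipschitz by blast
  have lin: "linear l" using l by (rule bounded_linear.linear)
  have "l (H 1) \<noteq> 0" "l (H (-1)) \<noteq> 0"
    using lL lR lin by (auto simp: H_def linear_neg)
  then obtain r1 T1 r2 T2 where r: "r1 > 0" "r2 > 0" and T: "T1 \<ge> 1" "T2 \<ge> 1"
    and 1: "\<And>x. norm (x - H 1) \<le> r1 \<Longrightarrow> \<exists>t. 1 \<le> t \<and> t \<le> T1 \<and> halves t x 1"
    and 2: "\<And>x. norm (x - H (-1)) \<le> r2 \<Longrightarrow> \<exists>t. 1 \<le> t \<and> t \<le> T2 \<and> halves t x (-1)"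
    using halves_near_equilibrium[of 1] halves_near_equilibrium[of "-1"] by blast
  define r where "r = min r1 r2"
  have r0: "r > 0" "r \<le> r1" "r \<le> r2" using r by (auto simp: r_def)
  \<comment> \<open>Pairs with \<open>norm (x - H y) > r * \<bar>y\<bar>\<close> land here after
    division by their distance to the equilibrium. The case \<open>y = 0\<close> is among
    them.\<close>
  define S where "S = {(x, y). norm (x - H y) = 1 \<and> \<bar>y\<bar> \<le> 1 / r}"
  have "compact S"
  proof -
    have "continuous_on UNIV (\<lambda>p::'a \<times> real. H (snd p))"
      by (rule continuous_on_compose2[OF continuous_on_H]) (auto intro!: continuous_intros)
    then have "closed {p. norm (fst p - H (snd p)) = 1 \<and> \<bar>snd p\<bar> \<le> 1 / r}"
      by (intro closed_Collect_conj closed_Collect_eq closed_Collect_le continuous_intros)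
    then have "closed S" unfolding S_def case_prod_unfold .
    moreover have "S \<subseteq> cball 0 (1 + (norm hL + norm hR) * (1 / r)) \<times> cball 0 (1 / r)"
    proof clarify
      fix x y assume "(x, y) \<in> S"
      then have *: "norm (x - H y) = 1" "\<bar>y\<bar> \<le> 1 / r" by (auto simp: S_def)
      have "norm x \<le> norm (x - H y) + norm (H y)" by (metis diff_add_cancel norm_triangle_ineq)
      also have "norm (H y) \<le> (norm hL + norm hR) * \<bar>y\<bar>" using H_lipschitz[of y 0] by simp
      also have "\<dots> \<le> (norm hL + norm hR) * (1 / r)" using * by (intro mult_left_mono) auto
      finally have "norm x \<le> 1 + (norm hL + norm hR) * (1 / r)" using * by simp
      then show "x \<in> cball 0 (1 + (norm hL + norm hR) * (1 / r)) \<and> y \<in> cball 0 (1 / r)"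
        using * by simp
    qed
    then have "bounded S" by (rule bounded_subset[rotated]) (intro bounded_Times bounded_cball)
    ultimately show ?thesis by (simp add: compact_eq_bounded_closed)
  qed
  moreover have "x \<noteq> H y" if "(x, y) \<in> S" for x y using that by (auto simp: S_def)
  ultimately obtain T3 where T3: "T3 \<ge> 1"
    "\<And>x y. (x, y) \<in> S \<Longrightarrow> \<exists>t. 1 \<le> t \<and> t \<le> T3 \<and> halves t x y"
    using halves_uniform_on_compact by metis
  define T0 where "T0 = max T1 (max T2 T3)"
  have T0: "T1 \<le> T0" "T2 \<le> T0" "T3 \<le> T0" by (auto simp: T0_def)
  have "\<exists>t. 1 \<le> t \<and> t \<le> T0 \<and> halves t x y" for x y
  proof (cases "x = H y")
    case True
    then show ?thesis using T T0 by (intro exI[of _ 1]) (simp add: halves_def flow_equilibrium[OF L F_H])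
  next
    case False
    show ?thesis
    proof (cases "norm (x - H y) \<le> r * \<bar>y\<bar>")
      case near: True
      \<comment> \<open>Here \<open>y\<close> is nonzero because \<open>x\<close> differs from
        \<open>H y\<close>; division by its modulus leaves only the parameters 1 and -1.\<close>
      define c where "c = \<bar>y\<bar>"
      have c: "c > 0" using near False r0 by (cases "y = 0") (auto simp: c_def)
      have y: "c * sgn y = y" by (simp add: c_def abs_mult_sgn)
      have "x - H y = c *\<^sub>R ((1 / c) *\<^sub>R x - H (sgn y))"
        using H_scale[of c "sgn y"] c y by (simp add: scaleR_diff_right)
      then have "norm (x - H y) = c * norm ((1 / c) *\<^sub>R x - H (sgn y))" using c by simp
      then have n: "norm ((1 / c) *\<^sub>R x - H (sgn y)) \<le> r"
        using near c by (simp add: c_def mult.commute)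
      have "sgn y = 1 \<or> sgn y = -1" using c by (auto simp: c_def sgn_if)
      then have "\<exists>t. 1 \<le> t \<and> t \<le> T0 \<and> halves t ((1 / c) *\<^sub>R x) (sgn y)"
      proof
        assume "sgn y = 1"
        then show ?thesis using 1[of "(1 / c) *\<^sub>R x"] n r0 T0 by fastforce
      next
        assume "sgn y = -1"
        then show ?thesis using 2[of "(1 / c) *\<^sub>R x"] n r0 T0 by fastforce
      qed
      then obtain t where "1 \<le> t" "t \<le> T0" "halves t ((1 / c) *\<^sub>R x) (sgn y)" by blast
      then show ?thesis
        using halves_scale[of t "(1 / c) *\<^sub>R x" "sgn y" c] c y by auto
    next
      case far: False
      define c where "c = norm (x - H y)"
      have c: "c > 0" using False by (simp add: c_def)
      have "x - H y = c *\<^sub>R ((1 / c) *\<^sub>R x - H (y / c))"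
        using H_scale[of c "y / c"] c by (simp add: scaleR_diff_right)
      then have "norm (x - H y) = c * norm ((1 / c) *\<^sub>R x - H (y / c))" using c by simp
      then have "norm ((1 / c) *\<^sub>R x - H (y / c)) = 1" using c by (simp add: c_def)
      moreover have "\<bar>y / c\<bar> \<le> 1 / r"
        using far c r0 by (simp add: c_def field_simps)
      ultimately obtain t where "1 \<le> t" "t \<le> T3" "halves t ((1 / c) *\<^sub>R x) (y / c)"
        using T3(2)[of "(1 / c) *\<^sub>R x" "y / c"] by (auto simp: S_def)
      then show ?thesis
        using halves_scale[of t "(1 / c) *\<^sub>R x" "y / c" c] c T0 by auto
    qed
  qed
  moreover have "T0 \<ge> 1" using T T0 by linarith
  ultimately show ?thesis by blast
qed

end

section \<open>Strong trapping regions under perturbation\<close>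

lemma smooth_on_C1:
  assumes "smooth_on U g" and x: "x \<in> U"
  shows smooth_on_has_derivative: "(g has_derivative frechet_derivative g (at x)) (at x)"
    and smooth_on_continuous_derivative: "continuous_on U (\<lambda>x. frechet_derivative g (at x) v)"
proof -
  have "Ck_on (Suc 0) U g" using assms(1) unfolding smooth_on_def by blast
  then obtain g' where g': "\<And>x. x \<in> U \<Longrightarrow> (g has_derivative g' x) (at x)"
    and c: "\<And>v. continuous_on U (\<lambda>x. g' x v)" by auto
  have *: "frechet_derivative g (at x) = g' x" if "x \<in> U" for x
    using frechet_derivative_at[OF g'[OF that]] by simp
  show "(g has_derivative frechet_derivative g (at x)) (at x)"
    using g' * x by simp
  show "continuous_on U (\<lambda>x. frechet_derivative g (at x) v)"
    using c[of v] by (rule continuous_on_eq) (simp add: *)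
qed

text \<open>A point with \<open>g q < 0\<close> would be interior, so \<open>g\<close> vanishes at
  all frontier points in \<open>U\<close>. One chart thus serves a whole neighbourhood, as the
  compactness argument requires.\<close>

lemma local_defining_function_at_other_point:
  assumes g: "local_defining_function S p U g" and S: "closed S" and q: "q \<in> frontier S" "q \<in> U"
  shows "local_defining_function S q U g"
proof -
  have U: "open U" and SU: "S \<inter> U = {x \<in> U. g x \<le> 0}" and sm: "smooth_on U g"
    using g by (auto simp: local_defining_function_def)
  have "q \<in> S" using q(1) S frontier_subset_closed by blast
  then have "g q \<le> 0" using SU q(2) by blast
  moreover have "\<not> g q < 0"
  proof
    assume "g q < 0"
    have "continuous_on U g"
      using smooth_on_has_derivative[OF sm] has_derivative_continuous continuous_at_imp_continuous_on by blast
    then have "open (U \<inter> g -` {..<0})" using U by (intro continuous_open_preimage) auto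
    moreover have "U \<inter> g -` {..<0} = {x \<in> U. g x < 0}" by auto
    ultimately have "open {x \<in> U. g x < 0}" by simp
    moreover have "{x \<in> U. g x < 0} \<subseteq> S" using SU by fastforce
    ultimately have "q \<in> interior S" using \<open>g q < 0\<close> q(2) by (auto intro: interiorI)
    then show False using q(1) by (simp add: frontier_def)
  qed
  ultimately show ?thesis using g q(2) by (auto simp: local_defining_function_def)
qed

lemma local_defining_function_chain:
  assumes "local_defining_function S p U g" "y t = p" "(y has_vector_derivative v) (at t)"
  shows "((\<lambda>s. g (y s)) has_real_derivative frechet_derivative g (at p) v) (at t)"
proof -
  have g': "(g has_derivative frechet_derivative g (at p)) (at (y t))"
    using assms smooth_on_has_derivative unfolding local_defining_function_def by metis
  have "((g \<circ> y) has_derivative frechet_derivative g (at p) \<circ> (\<lambda>h. h *\<^sub>R v)) (at t)"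
    using assms(3)[unfolded has_vector_derivative_def] g' by (rule diff_chain_at)
  moreover have "frechet_derivative g (at p) \<circ> (\<lambda>h. h *\<^sub>R v) = (*) (frechet_derivative g (at p) v)"
    using has_derivative_linear[OF g'] by (auto simp: linear_cmul)
  ultimately show ?thesis by (simp add: has_field_derivative_def o_def)
qed

lemma eventually_in_open_right:
  fixes y :: "real \<Rightarrow> 'a::real_normed_vector"
  assumes "open U" "y t \<in> U" "(y has_vector_derivative v) (at t)"
  shows "\<forall>\<^sub>F s in at_right t. y s \<in> U"
proof -
  have "(y \<longlongrightarrow> y t) (at_right t)"
    using has_vector_derivative_continuous[OF has_vector_derivative_at_within[OF assms(3)]]
    by (simp add: continuous_within)
  then show ?thesis using assms(1,2) by (rule topological_tendstoD)
qed

lemma inward_pointing_stays: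
  assumes g: "local_defining_function S p U g" and y: "y t = p" "(y has_vector_derivative v) (at t)"
    and neg: "frechet_derivative g (at p) v < 0"
  shows "\<forall>\<^sub>F s in at_right t. y s \<in> S"
proof -
  have U: "open U" "p \<in> U" "g p = 0" "S \<inter> U = {x \<in> U. g x \<le> 0}"
    using g by (auto simp: local_defining_function_def)
  obtain d where d: "d > 0" "\<And>h. h > 0 \<Longrightarrow> h < d \<Longrightarrow> g (y (t + h)) < g (y t)"
    using has_real_derivative_neg_dec_right[OF has_field_derivative_at_within[OF local_defining_function_chain[OF g y], of UNIV] neg]
    by auto
  have "\<forall>\<^sub>F s in at_right t. g (y s) \<le> 0"
    unfolding eventually_at_right_field
  proof (intro exI[of _ "t + d"] conjI allI impI)
    fix s assume "t < s" "s < t + d"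
    then show "g (y s) \<le> 0" using d(2)[of "s - t"] y U(3) by simp
  qed (use d in simp)
  moreover have "\<forall>\<^sub>F s in at_right t. y s \<in> U"
    using eventually_in_open_right[OF U(1) _ y(2)] U y by blast
  ultimately show ?thesis by eventually_elim (use U(4) in blast)
qed

text \<open>Nontangency alone leaves the side open; the trapping property decides it, because an
  outward velocity would carry the orbit to \<open>g > 0\<close> at once.\<close>

lemma trapping_region_not_outward:
  fixes f :: "'a::euclidean_space \<Rightarrow> 'a"
  assumes f: "L-lipschitz_on UNIV f" and tr: "trapping_region f S" and p: "p \<in> S"
    and g: "local_defining_function S p U g"
  shows "frechet_derivative g (at p) (f p) \<le> 0"
proof (rule ccontr)
  assume "\<not> ?thesis"
  then have pos: "frechet_derivative g (at p) (f p) > 0" by simp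
  let ?y = "\<lambda>t. flow f t p"
  have U: "open U" "p \<in> U" "g p = 0" "S \<inter> U = {x \<in> U. g x \<le> 0}"
    using g by (auto simp: local_defining_function_def)
  have y: "?y 0 = p" "(?y has_vector_derivative f p) (at 0)"
    using flow_zero[OF f] flow_has_derivative[OF f, of p 0] by simp_all
  obtain d where d: "d > 0" "\<And>h. h > 0 \<Longrightarrow> h < d \<Longrightarrow> g (?y 0) < g (?y (0 + h))"
    using has_real_derivative_pos_inc_right[OF has_field_derivative_at_within[OF local_defining_function_chain[OF g y], of UNIV] pos]
    by auto
  have "\<forall>\<^sub>F s in at_right 0. g (?y s) > 0"
    unfolding eventually_at_right_field using d y U(3) by (intro exI[of _ d]) auto
  moreover have "\<forall>\<^sub>F s in at_right 0. ?y s \<in> U"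
    using eventually_in_open_right[OF U(1) _ y(2)] U y by simp
  moreover have "\<forall>\<^sub>F s in at_right (0::real). s > 0" by (rule eventually_at_right_less)
  ultimately have "\<forall>\<^sub>F s in at_right (0::real). False"
  proof eventually_elim
    case (elim s)
    then have "?y s \<in> S \<inter> U" using tr p by (auto simp: trapping_region_def)
    then show False using U(4) elim by auto
  qed
  then show False by simp
qed

text \<open>Only the velocity of \<open>y\<close> at a single instant is constrained, since
  \<open>y\<close> will be the slow component of a full orbit and no solution of the reduced system.
  The factor \<open>c\<close> absorbs the slow time scale.\<close>

lemma strong_trapping_region_uniform:
  fixes f :: "'a::euclidean_space \<Rightarrow> 'a"
  assumes f: "L-lipschitz_on UNIV f" and S: "strong_trapping_region f S"
  shows "\<exists>\<eta>>0. \<forall>p\<in>frontier S. \<forall>v c y t. norm (v - f p) \<le> \<eta> \<longrightarrow> 0 < c \<longrightarrow> y t = p \<longrightarrow>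
    (y has_vector_derivative c *\<^sub>R v) (at t) \<longrightarrow> (\<forall>\<^sub>F s in at_right t. y s \<in> S)"
proof -
  have cS: "compact S" "closed S" using S compact_imp_closed by (auto simp: strong_trapping_region_def)
  define inward where "inward \<eta> q \<longleftrightarrow> (\<exists>U g. local_defining_function S q U g \<and>
    (\<forall>v. norm (v - f q) \<le> \<eta> \<longrightarrow> frechet_derivative g (at q) v < 0))" for \<eta> q
  have "\<exists>W \<eta>. open W \<and> p \<in> W \<and> \<eta> > 0 \<and> (\<forall>q\<in>W \<inter> frontier S. inward \<eta> q)"
    if p: "p \<in> frontier S" for p
  proof -
    obtain U g where g: "local_defining_function S p U g"
      using S p by (auto simp: strong_trapping_region_def smooth_boundary_def)
    have U: "open U" "p \<in> U" and sm: "smooth_on U g"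
      using g by (auto simp: local_defining_function_def)
    define D where "D q = frechet_derivative g (at q)" for q
    have lin: "linear (D q)" if "q \<in> U" for q
      unfolding D_def using smooth_on_has_derivative[OF sm that] by (rule has_derivative_linear)
    have cD: "continuous_on U (\<lambda>q. D q v)" for v
      unfolding D_def using smooth_on_continuous_derivative[OF sm U(2)] .
    have "D p (f p) \<noteq> 0"
      using S p g by (auto simp: strong_trapping_region_def tangent_to_frontier_def D_def)
    moreover have "D p (f p) \<le> 0"
      unfolding D_def
      using trapping_region_not_outward[OF f _ _ g] S p cS(2) frontier_subset_closed
      by (auto simp: strong_trapping_region_def)
    ultimately have neg: "D p (f p) < 0" by simp
    define K where "K q = (\<Sum>b\<in>Basis. \<bar>D q b\<bar>)" for q
    have K: "D q v \<le> K q * norm v" if "q \<in> U" for q v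
    proof -
      have "D q v = D q (\<Sum>b\<in>Basis. (v \<bullet> b) *\<^sub>R b)" by (simp add: euclidean_representation)
      also have "\<dots> = (\<Sum>b\<in>Basis. (v \<bullet> b) * D q b)"
        using lin[OF that] by (simp add: linear_sum linear_cmul)
      also have "\<dots> \<le> (\<Sum>b\<in>Basis. norm v * \<bar>D q b\<bar>)"
      proof (rule sum_mono)
        fix b :: 'a assume "b \<in> Basis"
        have "(v \<bullet> b) * D q b \<le> \<bar>v \<bullet> b\<bar> * \<bar>D q b\<bar>" by (metis abs_ge_self abs_mult)
        also have "\<dots> \<le> norm v * \<bar>D q b\<bar>"
          using \<open>b \<in> Basis\<close> by (intro mult_right_mono Basis_le_norm) auto
        finally show "(v \<bullet> b) * D q b \<le> norm v * \<bar>D q b\<bar>" .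
      qed
      finally show ?thesis by (simp add: K_def sum_distrib_left mult.commute)
    qed
    have K0: "K q \<ge> 0" for q unfolding K_def by (intro sum_nonneg) auto
    have cK: "continuous_on U K" unfolding K_def by (intro continuous_intros cD)
    define \<phi> where "\<phi> q = D q (f p) + K q * norm (f q - f p)" for q
    have cf: "continuous_on U f" using f lipschitz_on_continuous_on continuous_on_subset by blast
    have c\<phi>: "continuous_on U \<phi>" unfolding \<phi>_def by (intro continuous_intros cD cK cf)
    \<comment> \<open>Half of the margin at \<open>p\<close> is spent on moving from
      \<open>p\<close> to \<open>q\<close>, the other half on replacing \<open>f q\<close> by
      \<open>v\<close>; the latter fixes \<open>\<eta>\<close>.\<close>
    define m where "m = - D p (f p) / 2"
    define W where "W = U \<inter> \<phi> -` {..< - m} \<inter> (U \<inter> K -` {..< K p + 1})"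
    have "open W"
      unfolding W_def using cK c\<phi> U(1) by (intro open_Int continuous_open_preimage) auto
    moreover have "p \<in> W" using neg U(2) by (simp add: W_def \<phi>_def m_def)
    moreover
    define \<eta> where "\<eta> = m / (K p + 1)"
    have "m > 0" using neg by (simp add: m_def)
    then have "\<eta> > 0" using K0[of p] by (simp add: \<eta>_def)
    moreover have "frechet_derivative g (at q) v < 0" if "q \<in> W" "norm (v - f q) \<le> \<eta>" for q v
    proof -
      have q: "q \<in> U" "\<phi> q < - m" "K q < K p + 1" using that(1) by (auto simp: W_def)
      have "norm (v - f p) \<le> norm (f q - f p) + norm (v - f q)"
        using norm_triangle_ineq[of "f q - f p" "v - f q"] by simp
      then have n: "norm (v - f p) \<le> norm (f q - f p) + \<eta>" using that(2) by simp
      have "D q v = D q (f p) + D q (v - f p)"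
        using linear_add[OF lin[OF q(1)], of "f p" "v - f p"] by simp
      also have "\<dots> \<le> D q (f p) + K q * norm (v - f p)" using K[OF q(1), of "v - f p"] by simp
      also have "\<dots> \<le> D q (f p) + K q * (norm (f q - f p) + \<eta>)"
        using n K0[of q] by (intro add_left_mono mult_left_mono) auto
      also have "\<dots> = \<phi> q + K q * \<eta>" by (simp add: \<phi>_def algebra_simps)
      also have "K q * \<eta> \<le> (K p + 1) * \<eta>" using q(3) \<open>\<eta> > 0\<close> by (intro mult_right_mono) auto
      also have "\<dots> = m" using K0[of p] by (simp add: \<eta>_def)
      finally show ?thesis using q(2) by (simp add: D_def)
    qed
    moreover have "local_defining_function S q U g" if "q \<in> W" "q \<in> frontier S" for q
      using local_defining_function_at_other_point[OF g cS(2)] that by (auto simp: W_def)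
    ultimately show ?thesis unfolding inward_def by (intro exI[of _ W] exI[of _ \<eta>]) blast
  qed
  then obtain W \<eta> where
    W: "\<And>p. p \<in> frontier S \<Longrightarrow> open (W p)" "\<And>p. p \<in> frontier S \<Longrightarrow> p \<in> W p"
    and \<eta>: "\<And>p. p \<in> frontier S \<Longrightarrow> \<eta> p > (0::real)"
    and neg: "\<And>p q. p \<in> frontier S \<Longrightarrow> q \<in> W p \<Longrightarrow> q \<in> frontier S \<Longrightarrow> inward (\<eta> p) q"
    by (metis IntI)
  obtain D where D: "D \<subseteq> frontier S" "finite D" "frontier S \<subseteq> (\<Union>p\<in>D. W p)"
    using compactE_image[OF compact_frontier[OF cS(1)], of "frontier S" W] W by blast
  \<comment> \<open>The inserted 1 covers an empty frontier.\<close>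
  define \<eta>0 where "\<eta>0 = Min (insert 1 (\<eta> ` D))"
  have \<eta>0: "\<eta>0 > 0" "\<And>p. p \<in> D \<Longrightarrow> \<eta>0 \<le> \<eta> p" using D \<eta> by (auto simp: \<eta>0_def)
  have "\<forall>\<^sub>F s in at_right t. y s \<in> S"
    if q: "q \<in> frontier S" and v: "norm (v - f q) \<le> \<eta>0" and c: "0 < c"
      and y: "y t = q" "(y has_vector_derivative c *\<^sub>R v) (at t)" for q v c y t
  proof -
    obtain p where p: "p \<in> D" "q \<in> W p" "p \<in> frontier S" using D q by blast
    obtain U g where ldf: "local_defining_function S q U g"
      and n: "\<And>v. norm (v - f q) \<le> \<eta> p \<Longrightarrow> frechet_derivative g (at q) v < 0"
      using neg[OF p(3,2) q] unfolding inward_def by blast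
    have "linear (frechet_derivative g (at q))"
      using ldf smooth_on_has_derivative has_derivative_linear unfolding local_defining_function_def by metis
    moreover have "frechet_derivative g (at q) v < 0"
      by (rule n) (use v \<eta>0(2)[OF p(1)] in simp)
    ultimately have "frechet_derivative g (at q) (c *\<^sub>R v) < 0"
      using c by (simp add: linear_cmul mult_pos_neg)
    then show ?thesis by (rule inward_pointing_stays[OF ldf y])
  qed
  then show ?thesis using \<eta>0(1) by blast
qed

text \<open>Continuous induction: closedness puts the infimum of the exit times into
  \<open>S\<close>, and \<open>step\<close> continues past it. The premise of \<open>step\<close>
  makes estimates available that hold only while the orbit has stayed in \<open>S\<close>.\<close>

lemma forward_invariant_closedI:
  fixes z :: "real \<Rightarrow> 'a::topological_space"
  assumes S: "closed S" and z: "continuous_on UNIV z" and z0: "z 0 \<in> S"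
    and step: "\<And>t. t \<ge> 0 \<Longrightarrow> (\<And>s. 0 \<le> s \<Longrightarrow> s \<le> t \<Longrightarrow> z s \<in> S) \<Longrightarrow> \<forall>\<^sub>F s in at_right t. z s \<in> S"
    and t: "t \<ge> 0"
  shows "z t \<in> S"
proof (rule ccontr)
  assume nt: "z t \<notin> S"
  define B where "B = {s. s \<ge> 0 \<and> z s \<notin> S}"
  define T where "T = Inf B"
  have B: "B \<noteq> {}" "bdd_below B" using t nt by (auto simp: B_def intro!: bdd_belowI[of _ 0])
  have T0: "T \<ge> 0" unfolding T_def by (rule cInf_greatest) (use B in \<open>auto simp: B_def\<close>)
  have below: "z s \<in> S" if "0 \<le> s" "s < T" for s
  proof (rule ccontr)
    assume "z s \<notin> S"
    then have "s \<in> B" using that(1) by (simp add: B_def)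
    then have "T \<le> s" unfolding T_def using B(2) by (rule cInf_lower)
    then show False using that(2) by simp
  qed
  have "z T \<in> S"
  proof (cases "T = 0")
    case False
    then have "T > 0" using T0 by simp
    have "(z \<longlongrightarrow> z T) (at_left T)"
      using z by (simp add: continuous_on_eq_continuous_at isCont_def filterlim_at_split)
    moreover have "\<forall>\<^sub>F s in at_left T. z s \<in> S"
      unfolding eventually_at_left_field using \<open>T > 0\<close> below by (intro exI[of _ 0]) auto
    ultimately show ?thesis by (intro Lim_in_closed_set[OF S]) auto
  qed (use z0 in simp)
  then have "z s \<in> S" if "0 \<le> s" "s \<le> T" for s using below that by (cases "s = T") auto
  from step[OF T0 this] obtain b where b: "b > T" "\<And>s. T < s \<Longrightarrow> s < b \<Longrightarrow> z s \<in> S"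
    unfolding eventually_at_right_field by blast
  obtain s where s: "s \<in> B" "s < b" using cInf_lessD[OF B(1)] b(1) unfolding T_def by blast
  then have "T \<le> s" using cInf_lower[OF _ B(2)] by (simp add: T_def)
  then show False using s b(2)[of s] \<open>z T \<in> S\<close> by (cases "s = T") (auto simp: B_def)
qed

section \<open>Invariance of the tube\<close>

lemma vector_derivative_bound:
  fixes y :: "real \<Rightarrow> 'a::real_normed_vector"
  assumes "s \<le> t" and "\<And>r. s \<le> r \<Longrightarrow> r \<le> t \<Longrightarrow> (y has_vector_derivative y' r) (at r)"
    and "\<And>r. s \<le> r \<Longrightarrow> r \<le> t \<Longrightarrow> norm (y' r) \<le> B"
  shows "norm (y t - y s) \<le> B * (t - s)"
proof -
  have "norm (y t - y s) \<le> B * norm (t - s)"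
  proof (rule differentiable_bound[where S = "{s..t}"])
    fix r assume r: "r \<in> {s..t}"
    show "(y has_derivative (\<lambda>h. h *\<^sub>R y' r)) (at r within {s..t})"
      using assms(2)[of r] r by (simp add: has_vector_derivative_def has_derivative_at_withinI)
    show "onorm (\<lambda>h. h *\<^sub>R y' r) \<le> B"
      using assms(3)[of r] r by (simp add: onorm_scaleR_left bounded_linear_ident onorm_id)
  qed (use assms(1) in auto)
  then show ?thesis using assms(1) by simp
qed

lemma mult_bound:
  fixes f :: "'a::real_normed_vector \<Rightarrow> 'b::real_normed_vector"
  assumes "K > 0" "\<And>x. norm (f x) \<le> norm x * K" "norm x \<le> r"
  shows "norm (f x) \<le> r * K"
  using order_trans[OF assms(2) mult_right_mono[OF assms(3)]] assms(1) by simp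

lemma norm_min_max_scaleR_le:
  assumes "\<bar>r\<bar> \<le> R" "norm a \<le> A" "norm b \<le> B"
  shows "norm (min r 0 *\<^sub>R a + max r 0 *\<^sub>R b) \<le> R * (A + B)"
proof -
  have R: "R \<ge> 0" using assms(1) by linarith
  have "norm (min r 0 *\<^sub>R a + max r 0 *\<^sub>R b) \<le> \<bar>min r 0\<bar> * norm a + \<bar>max r 0\<bar> * norm b"
    by (rule order_trans[OF norm_triangle_ineq]) simp
  also have "\<dots> \<le> R * A + R * B"
    using assms R by (intro add_mono mult_mono) auto
  finally show ?thesis by (simp add: algebra_simps)
qed

context stable_layer
begin

text \<open>
  The tube argument: with \<open>w = x - H (\<pi> y)\<close>, comparing \<open>x\<close> on a time window of length \<open>T\<close>
  with the layer solution for frozen \<open>\<pi> y\<close> gives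
  \<open>norm (w r) \<le> norm (w s) / 2 + \<epsilon> C\<close> for some \<open>r\<close> in the window. Hence \<open>norm w\<close> returns to
  \<open>\<epsilon> M\<close>, \<open>M = 2 C + 1\<close>, again and again and cannot reach \<open>\<epsilon> N\<close> in between; meanwhile
  \<open>y\<close> follows a small perturbation of the reduced field and cannot cross the frontier.
\<close>

lemma tube_invariance:
  fixes \<pi> :: "'b::euclidean_space \<Rightarrow> real" and G :: "'b \<Rightarrow> 'b" and k dL dR :: 'b
    and aL aR :: "real \<Rightarrow> 'a" and bL bR :: "real \<Rightarrow> 'b" and \<Omega> :: "'b set"
  defines "X \<equiv> \<lambda>\<epsilon> (x, y). (J x - min (l x) 0 *\<^sub>R aL \<epsilon> - max (l x) 0 *\<^sub>R aR \<epsilon> + \<pi> y *\<^sub>R e,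
      \<epsilon> *\<^sub>R (G y + k - (min (l x) 0 *\<^sub>R bL \<epsilon> + max (l x) 0 *\<^sub>R bR \<epsilon>)))"
    and "f \<equiv> \<lambda>y. G y + k - (min (l (H (\<pi> y))) 0 *\<^sub>R dL + max (l (H (\<pi> y))) 0 *\<^sub>R dR)"
    and "tub \<equiv> \<lambda>\<delta>. {(x, y). norm (x - H (\<pi> y)) \<le> \<delta> \<and> y \<in> \<Omega>}"
  assumes \<pi>: "bounded_linear \<pi>" and G: "bounded_linear G"
    and aL: "\<forall>\<^sub>F \<epsilon> in at_right 0. norm (aL \<epsilon> - cL) \<le> A * \<epsilon>"
    and aR: "\<forall>\<^sub>F \<epsilon> in at_right 0. norm (aR \<epsilon> - cR) \<le> A * \<epsilon>"
    and bL: "(bL \<longlongrightarrow> dL) (at_right 0)" and bR: "(bR \<longlongrightarrow> dR) (at_right 0)"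
    and trap: "strong_trapping_region f \<Omega>"
  shows "\<exists>M N. 0 < M \<and> M \<le> N \<and> (\<forall>\<^sub>F \<epsilon> in at_right 0.
    \<forall>z0\<in>tub (\<epsilon> * M). \<forall>t\<ge>0. flow (X \<epsilon>) t z0 \<in> tub (\<epsilon> * N))"
proof -
  have cpt: "compact \<Omega>" and clo: "closed \<Omega>"
    using trap compact_imp_closed by (auto simp: strong_trapping_region_def)
  obtain L where L: "\<And>y. L-lipschitz_on UNIV (F y)" using F_lipschitz by blast
  have L0: "L \<ge> 0" using L[of 0] by (rule lipschitz_on_nonneg)
  obtain T where T: "T \<ge> 1" "\<And>x y. \<exists>t. 1 \<le> t \<and> t \<le> T \<and> halves t x y"
    using uniform_halving by blast
  have glH: "globally_lipschitz H"
    unfolding H_def[abs_def]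
    by (intro globally_lipschitz_intros globally_lipschitz_bounded_linear bounded_linear_ident)
  have lpi: "globally_lipschitz \<pi>" "globally_lipschitz G" "globally_lipschitz l"
    using \<pi> G l by (simp_all add: globally_lipschitz_bounded_linear)
  have "globally_lipschitz f"
    unfolding f_def
    by (intro globally_lipschitz_intros lpi globally_lipschitz_compose[OF lpi(3)]
        globally_lipschitz_compose[OF glH])
  then obtain Lf where Lf: "Lf-lipschitz_on UNIV f" by (auto simp: globally_lipschitz_def)
  obtain \<eta> where \<eta>: "\<eta> > 0" and stay: "\<And>p v c y t. p \<in> frontier \<Omega> \<Longrightarrow> norm (v - f p) \<le> \<eta> \<Longrightarrow> 0 < c \<Longrightarrow>
      y t = p \<Longrightarrow> (y has_vector_derivative c *\<^sub>R v) (at t) \<Longrightarrow> \<forall>\<^sub>F s in at_right t. y s \<in> \<Omega>"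
    using strong_trapping_region_uniform[OF Lf trap] by blast
  have Xlip: "\<exists>L. L-lipschitz_on UNIV (X \<epsilon>)" for \<epsilon>
    unfolding globally_lipschitz_def[symmetric] X_def case_prod_unfold
    by (intro globally_lipschitz_intros globally_lipschitz_bounded_linear
        bounded_linear_compose[OF J] bounded_linear_compose[OF l] bounded_linear_compose[OF \<pi>]
        bounded_linear_compose[OF G] bounded_linear_fst bounded_linear_snd)

  obtain Kl where Kl: "Kl > 0" "\<And>x. norm (l x) \<le> norm x * Kl"
    using bounded_linear.pos_bounded[OF l] by blast
  obtain Kp where Kp: "Kp > 0" "\<And>x. norm (\<pi> x) \<le> norm x * Kp"
    using bounded_linear.pos_bounded[OF \<pi>] by blast
  obtain KG where KG: "KG > 0" "\<And>x. norm (G x) \<le> norm x * KG"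
    using bounded_linear.pos_bounded[OF G] by blast
  obtain R where R: "R > 0" "\<And>y. y \<in> \<Omega> \<Longrightarrow> norm y \<le> R"
    using compact_imp_bounded[OF cpt] unfolding bounded_pos by blast
  have ldiff: "l a - l b = l (a - b)" for a b
    using bounded_linear.linear[OF l] by (simp add: linear_diff)
  have pdiff: "\<pi> a - \<pi> b = \<pi> (a - b)" for a b
    using bounded_linear.linear[OF \<pi>] by (simp add: linear_diff)
  define CH where "CH = norm hL + norm hR"
  have CH: "CH \<ge> 0" "\<And>y y'. norm (H y - H y') \<le> CH * \<bar>y - y'\<bar>"
    using H_lipschitz by (auto simp: CH_def)
  define RH where "RH = CH * (R * Kp)"
  define Rl where "Rl = (1 + RH) * Kl"
  define Cv where "Cv = R * KG + norm k + Rl * ((norm dL + 1) + (norm dR + 1))"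
  define E where "E = exp ((2 * L + 1) * T)"
  define D where "D = Kp * Cv * T * norm e + Rl * (\<bar>A\<bar> + \<bar>A\<bar>)"
  define C where "C = E * (D * (1 + T)) + CH * (Kp * Cv * T)"
  \<comment> \<open>One halving followed by the error \<open>\<epsilon> * C\<close> leads from
    \<open>\<epsilon> * M\<close> back to at most \<open>\<epsilon> * M\<close>. Over one window the
    deviation grows to at most \<open>\<epsilon> * (E * M + C)\<close>; the 1 in \<open>N\<close>
    makes the bound strict, so that it persists for a short time.\<close>
  define M where "M = 2 * C + 1"
  define N where "N = E * M + C + 1"
  have RH0: "RH \<ge> 0" using CH R Kp by (simp add: RH_def)
  have Rl0: "Rl > 0" using RH0 Kl by (simp add: Rl_def add_pos_nonneg)
  have Cv0: "Cv > 0" using Rl0 R KG by (simp add: Cv_def add_nonneg_pos add_pos_nonneg)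
  have E1: "E \<ge> 1" using L0 T by (simp add: E_def)
  have D0: "D \<ge> 0" using Kp Cv0 T Rl0 by (simp add: D_def)
  have C0: "C \<ge> 0" using E1 D0 T CH Kp Cv0 by (simp add: C_def)
  have M0: "M > 0" using C0 by (simp add: M_def)
  have EM: "M \<le> E * M" using mult_right_mono[OF E1, of M] M0 by simp
  have MN: "M \<le> N" and N0: "N > 0" using EM C0 M0 unfolding N_def by linarith+

  \<comment> \<open>Bound for the distance between the rescaled slow velocity and the reduced field:
    the first summand stems from \<open>x\<close> deviating from the critical manifold, the second
    from the change of \<open>bL\<close> and \<open>bR\<close>.\<close>
  define \<zeta> where "\<zeta> \<epsilon> = Kl * (\<epsilon> * N) * ((norm dL + 1) + (norm dR + 1))
    + Rl * (norm (bL \<epsilon> - dL) + norm (bR \<epsilon> - dR))" for \<epsilon>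
  have "(\<zeta> \<longlongrightarrow> Kl * (0 * N) * ((norm dL + 1) + (norm dR + 1)) + Rl * (norm (dL - dL) + norm (dR - dR))) (at_right 0)"
    unfolding \<zeta>_def by (intro tendsto_intros bL bR)
  then have "(\<zeta> \<longlongrightarrow> 0) (at_right 0)" by simp
  then have ev\<zeta>: "\<forall>\<^sub>F \<epsilon> in at_right 0. \<zeta> \<epsilon> < \<eta>" using \<eta> by (rule order_tendstoD)
  have evb: "\<forall>\<^sub>F \<epsilon> in at_right 0. dist (bL \<epsilon>) dL < 1" "\<forall>\<^sub>F \<epsilon> in at_right 0. dist (bR \<epsilon>) dR < 1"
    using tendstoD[OF bL, of 1] tendstoD[OF bR, of 1] by simp_all
  have evN: "\<forall>\<^sub>F \<epsilon> in at_right 0. \<epsilon> < 1 / N"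
    unfolding eventually_at_right_field using N0 by (intro exI[of _ "1 / N"]) auto
  have evpos: "\<forall>\<^sub>F \<epsilon> in at_right (0::real). 0 < \<epsilon>" by (rule eventually_at_right_less)

  have "\<forall>\<^sub>F \<epsilon> in at_right 0. \<forall>z0\<in>tub (\<epsilon> * M). \<forall>t\<ge>0. flow (X \<epsilon>) t z0 \<in> tub (\<epsilon> * N)"
    using ev\<zeta> evb evN evpos aL aR
  proof (eventually_elim, intro ballI allI impI)
    fix \<epsilon> z0 and t :: real
    assume \<zeta>: "\<zeta> \<epsilon> < \<eta>" and b: "dist (bL \<epsilon>) dL < 1" "dist (bR \<epsilon>) dR < 1"
      and N: "\<epsilon> < 1 / N" and \<epsilon>: "0 < \<epsilon>"
      and a': "norm (aL \<epsilon> - cL) \<le> A * \<epsilon>" "norm (aR \<epsilon> - cR) \<le> A * \<epsilon>"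
      and z0: "z0 \<in> tub (\<epsilon> * M)" and t: "t \<ge> 0"
    have N1: "\<epsilon> * N \<le> 1" using N N0 by (simp add: field_simps)
    have a: "norm (aL \<epsilon> - cL) \<le> \<bar>A\<bar> * \<epsilon>" "norm (aR \<epsilon> - cR) \<le> \<bar>A\<bar> * \<epsilon>"
      using a' \<epsilon> by (auto intro: order_trans mult_right_mono)
    have nb: "norm (bL \<epsilon>) \<le> norm dL + 1" "norm (bR \<epsilon>) \<le> norm dR + 1"
      using b norm_triangle_ineq2[of "bL \<epsilon>" dL] norm_triangle_ineq2[of "bR \<epsilon>" dR] by (auto simp: dist_norm)
    obtain LX where LX: "LX-lipschitz_on UNIV (X \<epsilon>)" using Xlip by blast
    define z where "z t = flow (X \<epsilon>) t z0" for t
    define x where "x t = fst (z t)" for t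
    define y where "y t = snd (z t)" for t
    define w where "w t = x t - H (\<pi> (y t))" for t
    define x' where "x' t = J (x t) - min (l (x t)) 0 *\<^sub>R aL \<epsilon> - max (l (x t)) 0 *\<^sub>R aR \<epsilon> + \<pi> (y t) *\<^sub>R e" for t
    define v where "v t = G (y t) + k - (min (l (x t)) 0 *\<^sub>R bL \<epsilon> + max (l (x t)) 0 *\<^sub>R bR \<epsilon>)" for t
    have zder: "(z has_vector_derivative X \<epsilon> (z t)) (at t)" for t
      unfolding z_def by (rule flow_has_derivative[OF LX])
    have Xz: "X \<epsilon> (z t) = (x' t, \<epsilon> *\<^sub>R v t)" for t
      by (simp add: X_def x'_def v_def x_def y_def case_prod_unfold)
    have xder: "(x has_vector_derivative x' t) (at t)" for t
      using bounded_linear.has_vector_derivative[OF bounded_linear_fst zder[of t]] Xz by (simp add: x_def[abs_def])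
    have yder: "(y has_vector_derivative \<epsilon> *\<^sub>R v t) (at t)" for t
      using bounded_linear.has_vector_derivative[OF bounded_linear_snd zder[of t]] Xz by (simp add: y_def[abs_def])
    have xc: "continuous_on UNIV x" by (rule continuous_on_vector_derivative) (use xder in blast)
    have yc: "continuous_on UNIV y" by (rule continuous_on_vector_derivative) (use yder in blast)
    have zc: "continuous_on UNIV z" by (rule continuous_on_vector_derivative) (use zder in blast)
    have \<pi>c: "continuous_on S \<pi>" for S by (rule linear_continuous_on[OF \<pi>])
    have Hc: "continuous_on S (\<lambda>y. H (\<pi> y))" for S
      by (rule continuous_on_compose2[OF continuous_on_H \<pi>c]) auto
    have wc: "continuous_on UNIV w"
      unfolding w_def by (intro continuous_intros xc continuous_on_compose2[OF Hc[of UNIV] yc]) auto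
    have tubz: "z s \<in> tub \<delta> \<longleftrightarrow> norm (w s) \<le> \<delta> \<and> y s \<in> \<Omega>" for s \<delta>
      by (simp add: tub_def w_def x_def y_def case_prod_unfold)
    have z00: "z 0 = z0" unfolding z_def by (rule flow_zero[OF LX])
    have closed: "closed (tub \<delta>)" for \<delta>
    proof -
      have "continuous_on UNIV (\<lambda>p::'a \<times> 'b. H (\<pi> (snd p)))"
        by (rule continuous_on_compose2[OF Hc[of UNIV] continuous_on_snd]) (auto intro: continuous_intros)
      then have "closed {p. norm (fst p - H (\<pi> (snd p))) \<le> \<delta>}"
        by (intro closed_Collect_le continuous_intros)
      moreover have "closed (UNIV \<times> \<Omega> :: ('a \<times> 'b) set)" using clo by (intro closed_Times) auto
      moreover have "tub \<delta> = {p. norm (fst p - H (\<pi> (snd p))) \<le> \<delta>} \<inter> (UNIV \<times> \<Omega>)"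
        by (auto simp: tub_def)
      ultimately show ?thesis by (simp only: closed_Int)
    qed
    have "z t \<in> tub (\<epsilon> * N)"
    proof (rule forward_invariant_closedI[OF closed zc _ _ t])
      have "\<epsilon> * M \<le> \<epsilon> * N" using MN \<epsilon> by simp
      then show "z 0 \<in> tub (\<epsilon> * N)" using z0 unfolding z00 by (auto simp: tub_def)
    next
      fix t :: real assume t: "t \<ge> 0" and in_tub: "\<And>s. 0 \<le> s \<Longrightarrow> s \<le> t \<Longrightarrow> z s \<in> tub (\<epsilon> * N)"
      have w: "norm (w s) \<le> \<epsilon> * N" and yO: "y s \<in> \<Omega>" if "0 \<le> s" "s \<le> t" for s
        using in_tub[OF that] tubz by auto
      have lH: "norm (H (\<pi> (y s))) \<le> RH" if "0 \<le> s" "s \<le> t" for s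
      proof -
        have "norm (y s) \<le> R" using R(2) yO that by blast
        have "norm (H (\<pi> (y s))) \<le> CH * \<bar>\<pi> (y s)\<bar>" using CH(2)[of "\<pi> (y s)" 0] by simp
        also have "\<dots> \<le> CH * (R * Kp)"
          using mult_bound[OF Kp \<open>norm (y s) \<le> R\<close>] CH(1) by (intro mult_left_mono) auto
        finally show ?thesis by (simp add: RH_def)
      qed
      have lH': "\<bar>l (H (\<pi> (y s)))\<bar> \<le> Rl" and lx: "\<bar>l (x s)\<bar> \<le> Rl" if "0 \<le> s" "s \<le> t" for s
      proof -
        have "norm (x s) \<le> norm (w s) + norm (H (\<pi> (y s)))"
          unfolding w_def by (metis diff_add_cancel norm_triangle_ineq)
        then have "norm (x s) \<le> 1 + RH" using w[OF that] lH[OF that] N1 by linarith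
        then show "\<bar>l (x s)\<bar> \<le> Rl"
          using mult_bound[OF Kl] by (simp add: Rl_def)
        show "\<bar>l (H (\<pi> (y s)))\<bar> \<le> Rl"
          using mult_bound[OF Kl, of "H (\<pi> (y s))" "1 + RH"] lH[OF that] by (simp add: Rl_def)
      qed
      have v: "norm (v s) \<le> Cv" if "0 \<le> s" "s \<le> t" for s
      proof -
        have "norm (v s) \<le> norm (G (y s)) + norm k + norm (min (l (x s)) 0 *\<^sub>R bL \<epsilon> + max (l (x s)) 0 *\<^sub>R bR \<epsilon>)"
          unfolding v_def by (rule order_trans[OF norm_triangle_ineq4 add_right_mono[OF norm_triangle_ineq]])
        also have "\<dots> \<le> R * KG + norm k + Rl * ((norm dL + 1) + (norm dR + 1))"
          by (intro add_mono norm_min_max_scaleR_le lx nb mult_bound[OF KG] R(2) yO that order_refl)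
        finally show ?thesis by (simp add: Cv_def)
      qed
      have y_slow: "\<bar>\<pi> (y r) - \<pi> (y s)\<bar> \<le> \<epsilon> * (Kp * Cv * T)" if "0 \<le> s" "s \<le> r" "r \<le> t" "r - s \<le> T" for s r
      proof -
        have "norm (y r - y s) \<le> (\<epsilon> * Cv) * (r - s)"
          by (rule vector_derivative_bound[OF that(2) yder]) (use that v \<epsilon> in \<open>auto intro: mult_left_mono\<close>)
        also have "\<dots> \<le> (\<epsilon> * Cv) * T" using that \<epsilon> Cv0 by (intro mult_left_mono) auto
        finally have "norm (y r - y s) * Kp \<le> \<epsilon> * Cv * T * Kp" using Kp(1) by (intro mult_right_mono) auto
        then show ?thesis using Kp(2)[of "y r - y s"] unfolding pdiff by (simp add: mult_ac)
      qed
      have x_layer: "norm (flow (F (\<pi> (y s))) (r - s) (x s) - x r) \<le> \<epsilon> * (E * (D * (1 + T)))"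
        if "0 \<le> s" "s \<le> r" "r \<le> t" "r - s \<le> T" for s r
      proof -
        \<comment> \<open>Two sources, both of order \<open>\<epsilon>\<close>: the drift of
          \<open>\<pi> y\<close> during the window and the change of \<open>aL\<close> and
          \<open>aR\<close> from their values at 0.\<close>
        have defect: "norm (x' q - F (\<pi> (y s)) (x q)) \<le> \<epsilon> * D" if q: "s \<le> q" "q \<le> r" for q
        proof -
          have q': "0 \<le> q" "q \<le> t" "q - s \<le> T" using q that \<open>0 \<le> s\<close> \<open>r \<le> t\<close> \<open>r - s \<le> T\<close> by linarith+
          have "x' q - F (\<pi> (y s)) (x q) = (\<pi> (y q) - \<pi> (y s)) *\<^sub>R e
            - (min (l (x q)) 0 *\<^sub>R (aL \<epsilon> - cL) + max (l (x q)) 0 *\<^sub>R (aR \<epsilon> - cR))"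
            by (simp add: x'_def F_def algebra_simps)
          also have "norm \<dots> \<le> norm ((\<pi> (y q) - \<pi> (y s)) *\<^sub>R e)
            + norm (min (l (x q)) 0 *\<^sub>R (aL \<epsilon> - cL) + max (l (x q)) 0 *\<^sub>R (aR \<epsilon> - cR))"
            by (rule norm_triangle_ineq4)
          also have "\<dots> \<le> (\<epsilon> * (Kp * Cv * T)) * norm e + Rl * (\<bar>A\<bar> * \<epsilon> + \<bar>A\<bar> * \<epsilon>)"
            unfolding norm_scaleR real_norm_def
            by (intro add_mono norm_min_max_scaleR_le lx a mult_right_mono y_slow) (use q q' \<open>0 \<le> s\<close> in auto)
          also have "\<dots> = \<epsilon> * D" by (simp add: D_def algebra_simps)
          finally show ?thesis .
        qed
        have "norm (flow (F (\<pi> (y s))) (r - s) (x s) - x r)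
          \<le> exp ((2 * L + 1) * (r - s)) * (norm (x s - x s) + (\<epsilon> * D) * (1 + (r - s)))"
          by (rule approximate_solution_flow_close[OF L that(2) xder defect])
        also have "\<dots> \<le> E * (0 + (\<epsilon> * D) * (1 + T))"
          unfolding E_def using that L0 D0 \<epsilon>
          by (intro mult_mono add_mono mult_left_mono) auto
        finally show ?thesis by (simp add: mult_ac)
      qed
      have w_layer: "norm (w r) \<le> norm (flow (F (\<pi> (y s))) (r - s) (x s) - H (\<pi> (y s))) + \<epsilon> * C"
        if "0 \<le> s" "s \<le> r" "r \<le> t" "r - s \<le> T" for s r
      proof -
        let ?u = "flow (F (\<pi> (y s))) (r - s) (x s)"
        have "norm (H (\<pi> (y r)) - H (\<pi> (y s))) \<le> CH * \<bar>\<pi> (y r) - \<pi> (y s)\<bar>" by (rule CH(2))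
        also have "\<dots> \<le> CH * (\<epsilon> * (Kp * Cv * T))" using CH(1) y_slow[OF that] by (rule mult_left_mono[rotated])
        finally have h: "norm (H (\<pi> (y r)) - H (\<pi> (y s))) \<le> \<epsilon> * (CH * (Kp * Cv * T))" by (simp add: mult_ac)
        have "w r = (?u - H (\<pi> (y s))) - (?u - x r) - (H (\<pi> (y r)) - H (\<pi> (y s)))"
          by (simp add: w_def)
        then have "norm (w r) \<le> norm (?u - H (\<pi> (y s))) + norm (?u - x r) + norm (H (\<pi> (y r)) - H (\<pi> (y s)))"
          by (simp only:) (rule order_trans[OF norm_triangle_ineq4 add_right_mono[OF norm_triangle_ineq4]])
        then show ?thesis using h x_layer[OF that] by (simp add: C_def algebra_simps)
      qed
      have w_window: "norm (w r) \<le> E * norm (w s) + \<epsilon> * C"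
        if "0 \<le> s" "s \<le> r" "r \<le> t" "r - s \<le> T" for s r
      proof -
        have "norm (flow (F (\<pi> (y s))) (r - s) (x s) - H (\<pi> (y s)))
          \<le> exp ((2 * L + 1) * (r - s)) * (norm (x s - H (\<pi> (y s))) + 0 * (1 + (r - s)))"
          by (rule approximate_solution_flow_close[OF L that(2), where v' = "\<lambda>_. 0"])
            (auto simp: F_H)
        also have "\<dots> \<le> E * norm (w s)"
          unfolding E_def w_def using that L0 by (simp, intro mult_right_mono) auto
        finally show ?thesis using w_layer[OF that] by linarith
      qed
      \<comment> \<open>Every time \<open>q\<close> has a return to radius
        \<open>\<epsilon> * M\<close> at most \<open>T\<close> earlier. The induction advances by
        unit steps: if the return \<open>s\<close> found for \<open>q - 1\<close> is too old for
        \<open>q\<close>, one halving replaces it by \<open>s + d\<close>. From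
        \<open>d \<le> T < q - s\<close> the new return is not later than \<open>q\<close>, and from
        \<open>1 \<le> d\<close> it is recent enough.\<close>
      have return: "\<forall>q. 0 \<le> q \<and> q \<le> t \<and> q \<le> real m \<longrightarrow>
          (\<exists>s. 0 \<le> s \<and> s \<le> q \<and> q - s \<le> T \<and> norm (w s) \<le> \<epsilon> * M)" for m
      proof (induction m)
        case 0
        have "norm (w 0) \<le> \<epsilon> * M" using z0 z00 tubz by metis
        then show ?case using T(1) by force
      next
        case (Suc m)
        show ?case
        proof (intro allI impI)
          fix q assume q: "0 \<le> q \<and> q \<le> t \<and> q \<le> real (Suc m)"
          show "\<exists>s. 0 \<le> s \<and> s \<le> q \<and> q - s \<le> T \<and> norm (w s) \<le> \<epsilon> * M"
          proof (cases "q \<le> T")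
            case True
            have "norm (w 0) \<le> \<epsilon> * M" using z0 z00 tubz by metis
            then show ?thesis using True q by force
          next
            case False
            then obtain s where s: "0 \<le> s" "s \<le> q - 1" "q - 1 - s \<le> T" "norm (w s) \<le> \<epsilon> * M"
              using Suc.IH[rule_format, of "q - 1"] q T(1) by auto
            show ?thesis
            proof (cases "q - s \<le> T")
              case True
              then show ?thesis using s by force
            next
              case False
              obtain d where d: "1 \<le> d" "d \<le> T" "halves d (x s) (\<pi> (y s))" using T(2) by blast
              have "norm (w (s + d)) \<le> norm (flow (F (\<pi> (y s))) (s + d - s) (x s) - H (\<pi> (y s))) + \<epsilon> * C"
                by (rule w_layer) (use s d False q in auto)
              also have "norm (flow (F (\<pi> (y s))) (s + d - s) (x s) - H (\<pi> (y s))) \<le> 1/2 * norm (w s)"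
                using d(3) by (simp add: halves_def w_def)
              also have "1/2 * norm (w s) + \<epsilon> * C \<le> \<epsilon> * M"
                using s(4) \<epsilon> by (simp add: M_def algebra_simps)
              finally have "norm (w (s + d)) \<le> \<epsilon> * M" by simp
              then show ?thesis using s d False by (intro exI[of _ "s + d"]) auto
            qed
          qed
        qed
      qed
      obtain m where "t \<le> real m" using real_arch_simple by blast
      then obtain s where s: "0 \<le> s" "s \<le> t" "t - s \<le> T" "norm (w s) \<le> \<epsilon> * M"
        using return[of m] t by blast
      have "norm (w t) \<le> E * norm (w s) + \<epsilon> * C" by (rule w_window) (use s in auto)
      also have "E * norm (w s) \<le> E * (\<epsilon> * M)" using s(4) E1 by (intro mult_left_mono) auto
      also have "E * (\<epsilon> * M) + \<epsilon> * C < \<epsilon> * N" using \<epsilon> by (simp add: N_def algebra_simps)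
      finally have wt: "norm (w t) < \<epsilon> * N" by simp
      have ev_w: "\<forall>\<^sub>F s in at_right t. norm (w s) < \<epsilon> * N"
      proof (rule order_tendstoD[OF _ wt])
        have "(w \<longlongrightarrow> w t) (at_right t)"
          using wc by (simp add: continuous_on_eq_continuous_at isCont_def filterlim_at_split)
        then show "((\<lambda>s. norm (w s)) \<longlongrightarrow> norm (w t)) (at_right t)" by (rule tendsto_norm)
      qed
      have ev_y: "\<forall>\<^sub>F s in at_right t. y s \<in> \<Omega>"
      proof (cases "y t \<in> interior \<Omega>")
        case True
        have "\<forall>\<^sub>F s in at_right t. y s \<in> interior \<Omega>"
          by (rule eventually_in_open_right[OF open_interior True yder])
        then show ?thesis by eventually_elim (use interior_subset in blast)
      next
        case False
        then have fr: "y t \<in> frontier \<Omega>"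
          using yO[of t] t clo by (simp add: frontier_def)
        let ?h = "l (H (\<pi> (y t)))"
        \<comment> \<open>The two perturbations are separated: coefficients first, at the point of
          the critical manifold; then the argument of \<open>l\<close>, with the perturbed
          coefficients.\<close>
        have "v t - f (y t) = - (min ?h 0 *\<^sub>R (bL \<epsilon> - dL) + max ?h 0 *\<^sub>R (bR \<epsilon> - dR))
          - ((min (l (x t)) 0 - min ?h 0) *\<^sub>R bL \<epsilon> + (max (l (x t)) 0 - max ?h 0) *\<^sub>R bR \<epsilon>)"
          by (simp add: v_def f_def algebra_simps)
        also have "norm \<dots> \<le> norm (min ?h 0 *\<^sub>R (bL \<epsilon> - dL) + max ?h 0 *\<^sub>R (bR \<epsilon> - dR))
          + norm ((min (l (x t)) 0 - min ?h 0) *\<^sub>R bL \<epsilon> + (max (l (x t)) 0 - max ?h 0) *\<^sub>R bR \<epsilon>)"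
          by (rule order_trans[OF norm_triangle_ineq4]) (simp only: norm_minus_cancel order_refl)
        also have "norm (min ?h 0 *\<^sub>R (bL \<epsilon> - dL) + max ?h 0 *\<^sub>R (bR \<epsilon> - dR))
          \<le> Rl * (norm (bL \<epsilon> - dL) + norm (bR \<epsilon> - dR))"
          by (rule norm_min_max_scaleR_le) (use lH'[of t] t in auto)
        also have "norm ((min (l (x t)) 0 - min ?h 0) *\<^sub>R bL \<epsilon> + (max (l (x t)) 0 - max ?h 0) *\<^sub>R bR \<epsilon>)
          \<le> (Kl * (\<epsilon> * N)) * (norm dL + 1) + (Kl * (\<epsilon> * N)) * (norm dR + 1)"
        proof -
          have "\<bar>l (x t) - ?h\<bar> \<le> norm (w t) * Kl" using Kl(2)[of "w t"] by (simp add: ldiff w_def)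
          also have "\<dots> \<le> (\<epsilon> * N) * Kl" using wt Kl(1) by (intro mult_right_mono) auto
          finally have *: "\<bar>l (x t) - ?h\<bar> \<le> Kl * (\<epsilon> * N)" by (simp add: mult.commute)
          have "\<bar>min (l (x t)) 0 - min ?h 0\<bar> \<le> Kl * (\<epsilon> * N)" "\<bar>max (l (x t)) 0 - max ?h 0\<bar> \<le> Kl * (\<epsilon> * N)"
            using * by linarith+
          then have "norm ((min (l (x t)) 0 - min ?h 0) *\<^sub>R bL \<epsilon>) \<le> (Kl * (\<epsilon> * N)) * (norm dL + 1)"
            "norm ((max (l (x t)) 0 - max ?h 0) *\<^sub>R bR \<epsilon>) \<le> (Kl * (\<epsilon> * N)) * (norm dR + 1)"
            unfolding norm_scaleR real_norm_def by (intro mult_mono nb; simp)+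
          then show ?thesis by (rule order_trans[OF norm_triangle_ineq add_mono])
        qed
        also have "Rl * (norm (bL \<epsilon> - dL) + norm (bR \<epsilon> - dR))
          + ((Kl * (\<epsilon> * N)) * (norm dL + 1) + (Kl * (\<epsilon> * N)) * (norm dR + 1)) = \<zeta> \<epsilon>"
          by (simp add: \<zeta>_def algebra_simps)
        finally have "norm (v t - f (y t)) \<le> \<eta>" using \<zeta> by simp
        then show ?thesis by (rule stay[OF fr _ \<epsilon> refl yder])
      qed
      show "\<forall>\<^sub>F s in at_right t. z s \<in> tub (\<epsilon> * N)"
        using ev_w ev_y by eventually_elim (simp add: tubz)
    qed
    then show "flow (X \<epsilon>) t z0 \<in> tub (\<epsilon> * N)" by (simp add: z_def)
  qed
  then show ?thesis using M0 MN by blast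
qed

end

section \<open>Matrices in observer form\<close>

lemma first_ix_le [simp]: "first_ix \<le> (i :: 'm::{finite,linorder})"
  by (simp add: first_ix_def)

lemma not_less_first_ix [simp]: "\<not> (i :: 'm::{finite,linorder}) < first_ix"
  by (simp add: not_less)

lemma le_last_ix [simp]: "(i :: 'm::{finite,linorder}) \<le> last_ix"
  by (simp add: last_ix_def)

lemma obs_mat_mult: "obs_mat a *v x = shift_mat *v x - x $ first_ix *\<^sub>R a"
proof -
  have "(\<chi> i j. a $ i * e_first $ j) *v x = x $ first_ix *\<^sub>R a"
    by (simp add: vec_eq_iff matrix_vector_mult_def e_first_def axis_def if_distrib if_distribR
        cong: if_cong)
  then show ?thesis by (simp add: obs_mat_def matrix_vector_mult_diff_rdistrib)
qed

lemma vec_shift_mat_first [simp]: "(a v* shift_mat) $ first_ix = 0"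
  by (simp add: vector_matrix_mult_def shift_mat_def)

text \<open>Here \<open>u\<close> is the vector of powers of \<open>r\<close> decreasing to exponent
  0, and the transposed shift reads the predecessor, whose exponent is larger by one. At the first
  index the product is 0 instead; there the characteristic equation will close the eigenvector
  relation.\<close>

lemma transpose_shift_mat_powers:
  fixes r :: real
  defines "u \<equiv> (\<chi> j. r ^ card {i. j < i}) :: 'm::{finite,linorder} rvec"
  assumes j: "j \<noteq> first_ix"
  shows "(transpose shift_mat *v u) $ j = r * u $ j"
proof -
  define p where "p = Max {i. i < j}"
  have "first_ix < j" using j first_ix_le[of j] by (simp add: order_less_le del: first_ix_le)
  then have ne: "{i. i < j} \<noteq> {}" by blast
  have p: "p < j" using Max_in[OF _ ne] by (simp add: p_def)
  have ple: "i \<le> p" if "i < j" for i using that by (simp add: p_def)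
  have "(i < j \<and> (\<nexists>l. i < l \<and> l < j)) \<longleftrightarrow> i = p" for i
    using p ple[of i] leD[OF ple] by (auto simp: order_less_le)
  then have "(transpose shift_mat *v u) $ j = u $ p"
    by (simp add: matrix_vector_mult_def transpose_def shift_mat_def if_distrib if_distribR cong: if_cong)
  moreover have "{i. p < i} = insert j {i. j < i}"
  proof (intro set_eqI iffI)
    fix i assume "i \<in> {i. p < i}"
    then show "i \<in> insert j {i. j < i}" using leD[OF ple, of i] by (cases i j rule: linorder_cases) auto
  qed (use p in auto)
  then have "card {i. p < i} = Suc (card {i. j < i})" by simp
  ultimately show ?thesis by (simp add: u_def)
qed

text \<open>
  The characteristic polynomial of \<open>obs_mat a\<close> has constant term \<open>a $ last_ix\<close>; the
  vector of decreasing powers of a root is an eigenvector of the transposed matrix.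
\<close>

lemma nonneg_root_exists:
  fixes a :: "'m::{finite,linorder} rvec"
  assumes "a $ last_ix \<le> 0"
  shows "\<exists>r\<ge>0. r ^ CARD('m) + (\<Sum>j\<in>UNIV. a $ j * r ^ card {i. j < i}) = 0"
proof -
  define q where "q r = r ^ CARD('m) + (\<Sum>j\<in>UNIV. a $ j * r ^ card {i. j < i})" for r :: real
  \<comment> \<open>Cauchy-type bound: the lower terms are at most
    \<open>(R - 1) * R ^ (CARD('m) - 1)\<close> in modulus, so the leading power dominates.\<close>
  define R where "R = 1 + (\<Sum>j\<in>UNIV. \<bar>a $ j\<bar>)"
  have R1: "R \<ge> 1" by (simp add: R_def sum_nonneg)
  \<comment> \<open>Since \<open>0 ^ 0 = 1\<close>, exactly the constant term survives at 0.\<close>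
  have "a $ j * 0 ^ card {i. j < i} = (if j = last_ix then a $ j else 0)" for j
  proof (cases "j = last_ix")
    case True
    then have "{i. j < i} = {}" by (auto simp: not_less)
    then show ?thesis using True by simp
  next
    case False
    then have "last_ix \<in> {i. j < i}" by (simp add: order_less_le)
    then have "card {i. j < i} > 0" unfolding card_gt_0_iff by (metis empty_iff finite)
    then have "(0 :: real) ^ card {i. j < i} = 0" by (rule zero_power)
    then show ?thesis using False by simp
  qed
  then have "q 0 \<le> 0" using assms by (simp add: q_def zero_power)
  moreover have "q R \<ge> 0"
  proof -
    have "- (a $ j * R ^ card {i. j < i}) \<le> \<bar>a $ j\<bar> * R ^ (CARD('m) - 1)" for j
    proof -
      have "card {i. j < i} \<le> card (UNIV - {j})" by (rule card_mono) auto
      then have "R ^ card {i. j < i} \<le> R ^ (CARD('m) - 1)" using R1 by (simp add: power_increasing)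
      then have "\<bar>a $ j\<bar> * R ^ card {i. j < i} \<le> \<bar>a $ j\<bar> * R ^ (CARD('m) - 1)" by (intro mult_left_mono) auto
      moreover have "- (a $ j) * R ^ card {i. j < i} \<le> \<bar>a $ j\<bar> * R ^ card {i. j < i}"
        using R1 by (intro mult_right_mono) auto
      ultimately show ?thesis by simp
    qed
    then have "(\<Sum>j\<in>UNIV. - (a $ j * R ^ card {i. j < i})) \<le> (\<Sum>j\<in>UNIV. \<bar>a $ j\<bar> * R ^ (CARD('m) - 1))"
      by (intro sum_mono)
    also have "\<dots> = (R - 1) * R ^ (CARD('m) - 1)" by (simp add: R_def sum_distrib_right)
    also have "\<dots> \<le> R * R ^ (CARD('m) - 1)" using R1 by (intro mult_right_mono) auto
    also have "\<dots> = R ^ CARD('m)" using power_minus_mult[of "CARD('m)" R] by (simp add: mult.commute)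
    finally show ?thesis by (simp add: q_def sum_negf)
  qed
  moreover have "continuous_on {0..R} q" unfolding q_def by (intro continuous_intros)
  ultimately obtain r where "0 \<le> r" "q r = 0" using IVT'[of q 0 0 R] R1 by auto
  then show ?thesis by (auto simp: q_def)
qed

text \<open>A square matrix and its transpose are singular together; this is applied to
  \<open>A - r *\<^sub>R mat 1\<close>. The real kernel vector is then read as a complex
  one.\<close>

lemma transpose_eigenvalue_imp_complex_eigenvalue:
  fixes A :: "'m::finite rmat"
  assumes "transpose A *v u = r *\<^sub>R u" "u \<noteq> 0"
  shows "complex_eigenvalue A (complex_of_real r)"
proof -
  define B where "B = A - r *\<^sub>R mat 1"
  have B: "B *v v = A *v v - r *\<^sub>R v" for v
    by (simp add: B_def matrix_vector_mult_diff_rdistrib scaleR_matrix_vector_assoc[symmetric])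
  have "transpose B *v u = 0"
  proof -
    have "transpose B = transpose A - r *\<^sub>R mat 1"
      by (simp add: B_def transpose_def vec_eq_iff mat_def)
    then show ?thesis
      using assms(1) by (simp add: matrix_vector_mult_diff_rdistrib scaleR_matrix_vector_assoc[symmetric])
  qed
  have "\<exists>v. v \<noteq> 0 \<and> B *v v = 0"
  proof (rule ccontr)
    assume "\<nexists>v. v \<noteq> 0 \<and> B *v v = 0"
    then obtain C where "C ** B = mat 1" using matrix_left_invertible_ker by blast
    then have "transpose B ** transpose C = mat 1" by (metis matrix_transpose_mul transpose_mat)
    then have "transpose C ** transpose B = mat 1" using matrix_left_right_inverse by blast
    then show False using matrix_left_invertible_ker \<open>transpose B *v u = 0\<close> assms(2) by blast
  qed
  then obtain v where v: "v \<noteq> 0" "A *v v = r *\<^sub>R v" using B by auto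
  let ?v = "\<chi> i. complex_of_real (v $ i)"
  have "(map_matrix complex_of_real A *v ?v) $ i = (complex_of_real r *s ?v) $ i" for i
  proof -
    have "(map_matrix complex_of_real A *v ?v) $ i = complex_of_real ((A *v v) $ i)"
      by (simp add: matrix_vector_mult_def)
    then show ?thesis using v by simp
  qed
  moreover have "?v \<noteq> 0" using v(1) by (simp add: vec_eq_iff)
  ultimately show ?thesis unfolding complex_eigenvalue_def vec_eq_iff by blast
qed

text \<open>Otherwise a nonnegative root would be an eigenvalue. The positivity gives the first
  coordinate of \<open>crit_H\<close> the sign of its argument and keeps the equilibria off the
  switching hyperplane.\<close>

lemma obs_mat_Hurwitz_imp_last_pos:
  fixes a :: "'m::{finite,linorder} rvec"
  assumes "\<And>c. complex_eigenvalue (obs_mat a) c \<Longrightarrow> Re c < 0"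
  shows "a $ last_ix > 0"
proof (rule ccontr)
  assume "\<not> ?thesis"
  then obtain r where r: "r \<ge> 0" "r ^ CARD('m) + (\<Sum>j\<in>UNIV. a $ j * r ^ card {i. j < i}) = 0"
    using nonneg_root_exists[of a] by auto
  define u :: "'m rvec" where "u = (\<chi> j. r ^ card {i. j < i})"
  have "transpose (obs_mat a) *v u = r *\<^sub>R u"
  proof (subst vec_eq_iff, rule allI)
    fix j :: 'm
    have "(transpose (obs_mat a) *v u) $ j = (transpose shift_mat *v u) $ j - (\<Sum>i\<in>UNIV. a $ i * u $ i) * e_first $ j"
      by (simp add: matrix_vector_mult_def transpose_def obs_mat_def algebra_simps sum_subtractf
          sum_distrib_left)
    also have "(\<Sum>i\<in>UNIV. a $ i * u $ i) = - (r ^ CARD('m))" using r(2) by (simp add: u_def)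
    also have "(transpose shift_mat *v u) $ j - - (r ^ CARD('m)) * e_first $ j = r * u $ j"
    proof (cases "j = first_ix")
      case True
      have "{i. first_ix < i} = UNIV - {first_ix :: 'm}"
        by (auto simp: order_less_le)
      then have "card {i. (first_ix :: 'm) < i} = CARD('m) - 1" by (simp add: card_Diff_singleton)
      then show ?thesis using True power_minus_mult[of "CARD('m)" r] by (simp add: e_first_def u_def mult.commute)
    next
      case False
      then show ?thesis using transpose_shift_mat_powers[OF False, of r] by (simp add: e_first_def u_def axis_def)
    qed
    finally show "(transpose (obs_mat a) *v u) $ j = (r *\<^sub>R u) $ j" by simp
  qed
  \<comment> \<open>For \<open>r = 0\<close> the last entry \<open>0 ^ 0 = 1\<close> is the only
    nonzero one.\<close>
  moreover have "u \<noteq> 0"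
  proof
    assume "u = 0"
    moreover have "{i. last_ix < (i :: 'm)} = {}" by (auto simp: not_less)
    then have "u $ last_ix = 1" unfolding u_def by (simp only: vec_lambda_beta card.empty power_0)
    ultimately show False by simp
  qed
  ultimately have "complex_eigenvalue (obs_mat a) (complex_of_real r)"
    by (rule transpose_eigenvalue_imp_complex_eigenvalue)
  from assms[OF this] r(1) show False by simp
qed

section \<open>The slow-fast observer canonical form\<close>

lemma C1_on_right_of_0:
  fixes g :: "real \<Rightarrow> 'a::real_normed_vector"
  assumes "C1_on {0..r} g" "r > 0"
  shows "\<exists>A. \<forall>\<^sub>F s in at_right 0. norm (g s - g 0) \<le> A * s" and "(g \<longlongrightarrow> g 0) (at_right 0)"
proof -
  obtain g' where g': "(g has_vector_derivative g') (at 0 within {0..r})"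
    using assms unfolding C1_on_def by fastforce
  then obtain d where d: "d > 0"
    "\<And>s. s \<in> {0..r} \<Longrightarrow> norm (s - 0) < d \<Longrightarrow> norm (g s - g 0 - (s - 0) *\<^sub>R g') \<le> 1 * norm (s - 0)"
    unfolding has_vector_derivative_def has_derivative_within_alt by (metis zero_less_one)
  \<comment> \<open>The 1 is the tolerance chosen in the definition of the one-sided derivative at
    0.\<close>
  have "norm (g s - g 0) \<le> (1 + norm g') * s" if "0 < s" "s < min r d" for s
  proof -
    have "norm (g s - g 0) \<le> norm (g s - g 0 - s *\<^sub>R g') + norm (s *\<^sub>R g')"
      by (metis diff_add_cancel norm_triangle_ineq)
    then show ?thesis using d(2)[of s] that by (simp add: algebra_simps)
  qed
  then have "\<forall>\<^sub>F s in at_right 0. norm (g s - g 0) \<le> (1 + norm g') * s"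
    unfolding eventually_at_right_field using assms(2) d(1) by (intro exI[of _ "min r d"]) auto
  then show "\<exists>A. \<forall>\<^sub>F s in at_right 0. norm (g s - g 0) \<le> A * s" by blast
  show "(g \<longlongrightarrow> g 0) (at_right 0)"
    using has_vector_derivative_continuous[OF g'] assms(2)
    by (simp add: continuous_within at_within_Icc_at_right)
qed

section \<open>The vector fields in min-max form\<close>

lemma layer_field_eq:
  "layer_field aL aR y x = shift_mat *v x - min (x $ first_ix) 0 *\<^sub>R aL 0
    - max (x $ first_ix) 0 *\<^sub>R aR 0 + y *\<^sub>R e_last"
  by (simp add: layer_field_def obs_mat_mult)

lemma crit_H_eq:
  "crit_H aL aR y = min y 0 *\<^sub>R ((1 / aL 0 $ last_ix) *\<^sub>R (e_first + transpose shift_mat *v aL 0))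
    + max y 0 *\<^sub>R ((1 / aR 0 $ last_ix) *\<^sub>R (e_first + transpose shift_mat *v aR 0))"
  by (simp add: crit_H_def Let_def)

lemma sfocf_field_eq:
  "sfocf_field aL aR bL bR \<mu> \<epsilon> = (\<lambda>(x, y).
    (shift_mat *v x - min (x $ first_ix) 0 *\<^sub>R aL \<epsilon> - max (x $ first_ix) 0 *\<^sub>R aR \<epsilon> + y $ first_ix *\<^sub>R e_last,
     \<epsilon> *\<^sub>R (shift_mat *v y + \<mu> *\<^sub>R e_last
       - (min (x $ first_ix) 0 *\<^sub>R bL \<epsilon> + max (x $ first_ix) 0 *\<^sub>R bR \<epsilon>))))"
  by (auto simp: sfocf_field_def obs_mat_mult fun_eq_iff)

lemma crit_H_first:
  "crit_H aL aR y $ first_ix = y / (if y \<le> 0 then aL 0 else aR 0) $ last_ix"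
  by (simp add: crit_H_def e_first_def Let_def)

text \<open>The reduced field is the slow field on the critical manifold. The choice between
  \<open>bL\<close> and \<open>bR\<close> by the sign of the fast coordinate agrees with the choice
  by the slow one because the last entries are positive.\<close>

lemma reduced_field_eq:
  assumes "aL 0 $ last_ix > 0" "aR 0 $ last_ix > 0"
  shows "reduced_field aL aR bL bR \<mu> y = shift_mat *v y + \<mu> *\<^sub>R e_last
    - (min (crit_H aL aR (y $ first_ix) $ first_ix) 0 *\<^sub>R bL 0
      + max (crit_H aL aR (y $ first_ix) $ first_ix) 0 *\<^sub>R bR 0)"
proof (cases "y $ first_ix \<le> 0")
  case True
  then have "y $ first_ix / aL 0 $ last_ix \<le> 0" using assms by (simp add: divide_le_0_iff)
  then show ?thesis using True
    by (simp add: reduced_field_def obs_mat_mult crit_H_first divide_inverse)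
next
  case False
  then have "y $ first_ix / aR 0 $ last_ix > 0" using assms by simp
  then show ?thesis using False
    by (simp add: reduced_field_def obs_mat_mult crit_H_first divide_inverse)
qed

theorem theorem4p1:
  fixes aL aR :: "real \<Rightarrow> ('k::{finite,linorder}) rvec"
    and bL bR :: "real \<Rightarrow> ('m::{finite,linorder}) rvec"
    and \<epsilon>1 \<mu> :: real
    and \<Omega> :: "'m rvec set"
  assumes "\<epsilon>1 > 0"
    and "C1_on {0..\<epsilon>1} aL" and "C1_on {0..\<epsilon>1} aR"
    and "C1_on {0..\<epsilon>1} bL" and "C1_on {0..\<epsilon>1} bR"
    and "critical_manifold_globally_stable aL aR"
    and "strong_trapping_region (reduced_field aL aR bL bR \<mu>) \<Omega>"
  shows "\<exists>M N \<epsilon>max. 0 < M \<and> M \<le> N \<and> 0 < \<epsilon>max \<and> \<epsilon>max \<le> \<epsilon>1 \<and>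
    (\<forall>\<epsilon>. 0 < \<epsilon> \<and> \<epsilon> < \<epsilon>max \<longrightarrow>
      (\<forall>z \<in> tube aL aR \<Omega> (\<epsilon> * M). \<forall>t\<ge>0.
         flow (sfocf_field aL aR bL bR \<mu> \<epsilon>) t z \<in> tube aL aR \<Omega> (\<epsilon> * N)))"
proof -
  have pos: "aL 0 $ last_ix > 0" "aR 0 $ last_ix > 0"
    using assms(6) obs_mat_Hurwitz_imp_last_pos unfolding critical_manifold_globally_stable_def by blast+
  let ?h = "\<lambda>a. (1 / a $ last_ix) *\<^sub>R (e_first + transpose shift_mat *v a) :: 'k rvec"
  \<comment> \<open>The interpretation comes in two stages: the stability assumption is stated for
    \<open>layer_field\<close> and \<open>crit_H\<close>, which must first be identified with the
    locale's \<open>F\<close> and \<open>H\<close>.\<close>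
  interpret piecewise_linear_layer "(*v) shift_mat" "\<lambda>x. x $ first_ix" "aL 0" "aR 0" e_last "?h (aL 0)" "?h (aR 0)"
    by (rule piecewise_linear_layer.intro) (rule matrix_vector_mul_bounded_linear bounded_linear_vec_nth)+
  have F: "F y = layer_field aL aR y" for y
    by (simp add: fun_eq_iff F_def layer_field_eq)
  have H: "H = crit_H aL aR"
    unfolding fun_eq_iff H_def crit_H_eq by blast
  interpret stable_layer "(*v) shift_mat" "\<lambda>x. x $ first_ix" "aL 0" "aR 0" e_last "?h (aL 0)" "?h (aR 0)"
  proof
    show "globally_asymptotically_stable (F y) (H y)" for y
      using assms(6) unfolding F H critical_manifold_globally_stable_def by blast
  qed (use pos in \<open>auto simp: e_first_def\<close>)
  obtain A1 A2 where A: "\<forall>\<^sub>F s in at_right 0. norm (aL s - aL 0) \<le> A1 * s"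
      "\<forall>\<^sub>F s in at_right 0. norm (aR s - aR 0) \<le> A2 * s"
    using C1_on_right_of_0(1)[OF assms(2,1)] C1_on_right_of_0(1)[OF assms(3,1)] by blast
  have ev_pos: "\<forall>\<^sub>F s in at_right (0::real). 0 < s" by (rule eventually_at_right_less)
  have le: "r \<le> max A1 A2 * s" if "r \<le> A * s" "A \<le> max A1 A2" "0 < s" for r A s :: real
    using order_trans[OF that(1) mult_right_mono[OF that(2)]] that(3) by simp
  have A': "\<forall>\<^sub>F s in at_right 0. norm (aL s - aL 0) \<le> max A1 A2 * s"
      "\<forall>\<^sub>F s in at_right 0. norm (aR s - aR 0) \<le> max A1 A2 * s"
    by (rule eventually_elim2[OF A(1) ev_pos], rule le, auto)
      (rule eventually_elim2[OF A(2) ev_pos], rule le, auto)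
  \<comment> \<open>This brings the trapping hypothesis into the shape of the field \<open>f\<close>
    of the tube argument.\<close>
  have red: "reduced_field aL aR bL bR \<mu> = (\<lambda>y. shift_mat *v y + \<mu> *\<^sub>R e_last
      - (min (H (y $ first_ix) $ first_ix) 0 *\<^sub>R bL 0 + max (H (y $ first_ix) $ first_ix) 0 *\<^sub>R bR 0))"
    unfolding H fun_eq_iff by (simp add: reduced_field_eq[where aL = aL and aR = aR, OF pos])
  obtain M N where MN: "0 < M" "M \<le> N" "\<forall>\<^sub>F \<epsilon> in at_right 0.
      \<forall>z\<in>tube aL aR \<Omega> (\<epsilon> * M). \<forall>t\<ge>0. flow (sfocf_field aL aR bL bR \<mu> \<epsilon>) t z \<in> tube aL aR \<Omega> (\<epsilon> * N)"
    using tube_invariance[of "\<lambda>y. y $ first_ix" "(*v) shift_mat" aL "max A1 A2" aR bL "bL 0" bR "bR 0" "\<mu> *\<^sub>R e_last" \<Omega>,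
        folded red, OF bounded_linear_vec_nth matrix_vector_mul_bounded_linear A'
          C1_on_right_of_0(2)[OF assms(4,1)] C1_on_right_of_0(2)[OF assms(5,1)] assms(7)]
    unfolding sfocf_field_eq tube_def H by blast
  from MN(3) obtain r where r: "r > 0" "\<And>\<epsilon>. 0 < \<epsilon> \<Longrightarrow> \<epsilon> < r \<Longrightarrow>
      \<forall>z\<in>tube aL aR \<Omega> (\<epsilon> * M). \<forall>t\<ge>0. flow (sfocf_field aL aR bL bR \<mu> \<epsilon>) t z \<in> tube aL aR \<Omega> (\<epsilon> * N)"
    unfolding eventually_at_right_field by blast
  show ?thesis
    by (rule exI[of _ M], rule exI[of _ N], rule exI[of _ "min r \<epsilon>1"]) (use MN(1,2) assms(1) r in auto)
qed

end
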